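(* Let $b\ge 100$ be a constant, let $\theta$ satisfy $\mathrm{tail}(1.99b)\le\theta\le 1/1600$, let $n$ be sufficiently large and $n'=n+\frac12(1.99b-1)\sqrt n$. Then \[ \mathrm{scb}^{1,\mu_n}_{400\theta,\theta}(\mathrm{GHD}_n)=\Omega\big(\mathrm{cb}^{1,\mu_{n'}}_{400\theta}(\mathrm{ORT}_{b,n'})\big)-O(\sqrt n), \] and consequently $\mathrm{IC}^{\mu_n}_\theta(\mathrm{GHD}_n)=\Omega\big(\mathrm{cb}^{1,\mu_{n'}}_{400\theta}(\mathrm{ORT}_{b,n'})\big)-O(\sqrt n)$.
   Context: $\mu_m$ is the uniform distribution on $\{-1,1\}^m\times\{-1,1\}^m$. $\mathrm{GHD}_n$ is the partial function on $\{-1,1\}^n\times\{-1,1\}^n$ with $\mathrm{GHD}_n(x,y)=-1$ if $\langle x,y\rangle\le-\sqrt n$, $=1$ if $\langle x,y\rangle\ge\sqrt n$, and $=*$ (undefined) otherwise. $\mathrm{ORT}_{b,m}(x,y)=1$ if $|\langle x,y\rangle|\le b\sqrt m$ and $-1$ otherwise. $\mathrm{tail}(x)=\frac{1}{\sqrt{2\pi}}\int_x^\infty e^{-s^2/2}ds$. For a distribution $\lambda$ and $g:\mathcal{X}\times\mathcal{Y}\to\mathcal{Z}\cup\{*\}$, $S$ is $\varepsilon$-error $z$-monochromatic for $g$ under $\lambda$ if $\lambda(S\setminus(g^{-1}(z)\cup g^{-1}( * )))\le\varepsilon\lambda(S)$; $\mathrm{cb}^{z,\lambda}_\varepsilon(g)=-\log_2\max\{\lambda(S):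 S \text{ a rectangle } S_1\times S_2, \varepsilon\text{-error } z\text{-monochromatic}\}$; $\mathrm{scb}^{z,\lambda}_{\varepsilon,\delta}(f)=\max\{\mathrm{cb}^{z,\lambda}_\varepsilon(g): \Pr_\lambda[f\ne g]\le\delta\}$ over all $g:\mathcal{X}\times\mathcal{Y}\to\mathcal{Z}\cup\{*\}$. Information complexity: for a two-party protocol $P$ with public randomness $R$, $(X,Y)\sim\lambda$, $\mathrm{icost}^\lambda(P)=I(XY:P(X,Y)\mid R)$; $P$ computes $f$ with error $\varepsilon$ if $\Pr[f(X,Y)\ne*\wedge\mathrm{out}(P(X,Y))\ne f(X,Y)]\le\varepsilon$; $\mathrm{IC}^\lambda_\varepsilon(f)$ is the minimum information cost over such protocols. *)

theory Defs
  imports "HOL-Probability.Probability"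
begin

definition tail :: "real \<Rightarrow> real" where
  "tail x = 1 / sqrt (2 * pi) * (LBINT s:{x..}. exp (- s\<^sup>2 / 2))"

definition cube :: "nat \<Rightarrow> int list set" where
  "cube m = {x. length x = m \<and> set x \<subseteq> {-1, 1}}"

definition \<mu> :: "nat \<Rightarrow> (int list \<times> int list) pmf" where
  "\<mu> m = pmf_of_set (cube m \<times> cube m)"

definition ip :: "nat \<Rightarrow> int list \<Rightarrow> int list \<Rightarrow> int" where
  "ip m x y = (\<Sum>i<m. x ! i * y ! i)"

text \<open>Partial functions take values in an option type, \<^term>\<open>None\<close> standing for the
  undefined value \<open>*\<close>.\<close>

definition GHD :: "nat \<Rightarrow> int list \<times> int list \<Rightarrow> int option" where
  "GHD n = (\<lambda>(x, y).
     if real_of_int (ip n x y) \<le> - sqrt (real n) then Some (-1)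
     else if real_of_int (ip n x y) \<ge> sqrt (real n) then Some 1
     else None)"

definition ORT :: "real \<Rightarrow> nat \<Rightarrow> int list \<times> int list \<Rightarrow> int option" where
  "ORT b m = (\<lambda>(x, y).
     if \<bar>real_of_int (ip m x y)\<bar> \<le> b * sqrt (real m) then Some 1 else Some (-1))"

definition monochromatic ::
  "('x \<times> 'y) pmf \<Rightarrow> real \<Rightarrow> 'z \<Rightarrow> ('x \<times> 'y \<Rightarrow> 'z option) \<Rightarrow> ('x \<times> 'y) set \<Rightarrow> bool" where
  "monochromatic \<nu> \<epsilon> z g S \<longleftrightarrow>
     measure_pmf.prob \<nu> (S - (g -` {Some z} \<union> g -` {None})) \<le> \<epsilon> * measure_pmf.prob \<nu> S"

text \<open>In the next two definitions the input sets \<open>X\<close> and \<open>Y\<close> and the set \<open>Z\<close> of outputs are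
  meant to be finite. The maximum in \<open>cb\<close> always exists (the empty rectangle qualifies), and
  \<open>-log\<^sub>2 0 = \<infinity>\<close>.\<close>

definition cb ::
  "'x set \<Rightarrow> 'y set \<Rightarrow> 'z \<Rightarrow> ('x \<times> 'y) pmf \<Rightarrow> real \<Rightarrow> ('x \<times> 'y \<Rightarrow> 'z option) \<Rightarrow> ereal" where
  "cb X Y z \<nu> \<epsilon> g =
     (let M = Max {measure_pmf.prob \<nu> (S1 \<times> S2) | S1 S2.
                     S1 \<subseteq> X \<and> S2 \<subseteq> Y \<and> monochromatic \<nu> \<epsilon> z g (S1 \<times> S2)}
      in if M = 0 then \<infinity> else ereal (- log 2 M))"

definition scb ::
  "'x set \<Rightarrow> 'y set \<Rightarrow> 'z set \<Rightarrow> 'z \<Rightarrow> ('x \<times> 'y) pmf \<Rightarrow> real \<Rightarrow> real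
    \<Rightarrow> ('x \<times> 'y \<Rightarrow> 'z option) \<Rightarrow> ereal" where
  "scb X Y Z z \<nu> \<epsilon> \<delta> f =
     Max (cb X Y z \<nu> \<epsilon> ` {g \<in> X \<times> Y \<rightarrow>\<^sub>E insert None (Some ` Z).
                              measure_pmf.prob \<nu> {p. f p \<noteq> g p} \<le> \<delta>})"

text \<open>A private-coin protocol is a finite binary tree. At an inner node its owner sends a bit drawn
  from a distribution depending on the owner's input, using fresh private randomness; \<open>True\<close>
  leads to the first subtree. Leaves carry the output.\<close>

datatype (dead 'x, dead 'y, outputs: 'z) ptree =
    Leaf 'z
  | Alice "'x \<Rightarrow> bool pmf" "('x, 'y, 'z) ptree" "('x, 'y, 'z) ptree"
  | Bob "'y \<Rightarrow> bool pmf" "('x, 'y, 'z) ptree" "('x, 'y, 'z) ptree"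

primrec transcript :: "('x, 'y, 'z) ptree \<Rightarrow> 'x \<Rightarrow> 'y \<Rightarrow> bool list pmf" where
  "transcript (Leaf z) x y = return_pmf []"
| "transcript (Alice q l r) x y = bind_pmf (q x)
     (\<lambda>a. map_pmf ((#) a) (if a then transcript l x y else transcript r x y))"
| "transcript (Bob q l r) x y = bind_pmf (q y)
     (\<lambda>a. map_pmf ((#) a) (if a then transcript l x y else transcript r x y))"

primrec out :: "('x, 'y, 'z) ptree \<Rightarrow> bool list \<Rightarrow> 'z" where
  "out (Leaf z) t = z"
| "out (Alice q l r) t = (if hd t then out l (tl t) else out r (tl t))"
| "out (Bob q l r) t = (if hd t then out l (tl t) else out r (tl t))"

text \<open>The public random string \<open>R\<close> is drawn first and selects the private-coin protocol to be run.
  As it is discrete, its values may be encoded as natural numbers.\<close>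

type_synonym ('x, 'y, 'z) protocol = "nat pmf \<times> (nat \<Rightarrow> ('x, 'y, 'z) ptree)"

definition protocols :: "'z set \<Rightarrow> ('x, 'y, 'z) protocol set" where
  "protocols Z = {P. \<forall>r. outputs (snd P r) \<subseteq> Z}"

text \<open>Joint distribution of \<open>R\<close>, \<open>(X, Y)\<close> and the transcript \<open>P(X, Y)\<close>.\<close>

definition execution ::
  "('x, 'y, 'z) protocol \<Rightarrow> ('x \<times> 'y) pmf \<Rightarrow> (nat \<times> ('x \<times> 'y) \<times> bool list) pmf" where
  "execution P \<nu> = bind_pmf (fst P) (\<lambda>r. bind_pmf \<nu> (\<lambda>(x, y).
     map_pmf (\<lambda>t. (r, (x, y), t)) (transcript (snd P r) x y)))"

text \<open>Countability of the input types makes the product of the discrete measurable spaces below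
  discrete again.\<close>

definition icost ::
  "('x::countable \<times> 'y::countable) pmf \<Rightarrow> ('x, 'y, 'z) protocol \<Rightarrow> real" where
  "icost \<nu> P = prob_space.conditional_mutual_information (measure_pmf (execution P \<nu>)) 2
     (count_space UNIV) (count_space UNIV) (count_space UNIV)
     (\<lambda>(r, xy, t). xy) (\<lambda>(r, xy, t). t) (\<lambda>(r, xy, t). r)"

definition computes ::
  "('x \<times> 'y) pmf \<Rightarrow> real \<Rightarrow> ('x \<times> 'y \<Rightarrow> 'z option) \<Rightarrow> ('x, 'y, 'z) protocol \<Rightarrow> bool" where
  "computes \<nu> \<epsilon> f P \<longleftrightarrow>
     measure_pmf.prob (execution P \<nu>)
       {(r, xy, t). f xy \<noteq> None \<and> Some (out (snd P r) t) \<noteq> f xy} \<le> \<epsilon>"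

definition IC ::
  "'z set \<Rightarrow> ('x::countable \<times> 'y::countable) pmf \<Rightarrow> real \<Rightarrow> ('x \<times> 'y \<Rightarrow> 'z option) \<Rightarrow> ereal" where
  "IC Z \<nu> \<epsilon> f = (INF P \<in> {P \<in> protocols Z. computes \<nu> \<epsilon> f P}. ereal (icost \<nu> P))"

end

theory Submission
  imports Defs "HOL-Real_Asymp.Real_Asymp"
begin

text \<open>
  Let \<open>g\<close> agree with GHD except that it takes the value \<open>-1\<close> wherever the inner product is at
  least \<open>a = 1.99 b \<surd>n + 5\<close>. A comparison of binomial coefficients with the Gaussian density, sharp up
  to a factor \<open>1 + O(1/n)\<close> that the constant \<open>5\<close> absorbs, shows that this changes GHD with
  probability at most \<open>tail (1.99 b) \<le> \<theta>\<close>. On a rectangle almost free of the value \<open>-1\<close> of \<open>g\<close> the inner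
  product lies between \<open>-\<surd>n\<close> and \<open>a\<close>; appending \<open>k = n' - n\<close> entries \<open>1\<close> to \<open>x\<close> and \<open>-1\<close> to \<open>y\<close>
  centres this interval at \<open>0\<close>, and the rectangle becomes one for ORT at the cost of a factor \<open>4\<^sup>k\<close>.

  For information complexity, let \<open>f\<close> be the density of the joint law of inputs, transcript and
  public coins with respect to the product of its marginals. The information cost \<open>I\<close> is the mean of
  \<open>f log f\<close>, so \<open>f > 2\<^sup>K\<close> is unlikely for \<open>K\<close> of order \<open>I\<close>. Averaging yields one transcript with
  output \<open>1\<close> whose posterior, a product distribution, has density mostly below \<open>2\<^sup>K\<close> and rarely
  meets \<open>g = -1\<close>. A bilinear form on a box is maximal at a vertex, so the posterior can be replaced by the
  uniform distribution on a rectangle of measure \<open>2\<^sup>-\<^sup>2\<^sup>K/512\<close>.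
\<close>

section \<open>Binomial coefficients\<close>

definition central :: "nat \<Rightarrow> real" where
  "central m = real ((2 * m) choose m) / 4 ^ m"

lemma central_Suc: "central (Suc m) = central m * (2 * real m + 1) / (2 * real m + 2)"
proof -
  have a: "Suc m * ((2 * m + 2) choose Suc m) = (2 * m + 2) * ((2 * m + 1) choose m)"
    using binomial_absorption[of m "2*m+2"] by (simp del: binomial_Suc_Suc)
  have sym: "((2 * m + 1) choose m) = ((2 * m + 1) choose Suc m)"
    using binomial_symmetric[of m "2*m+1"] by (simp del: binomial_Suc_Suc)
  have b: "Suc m * ((2 * m + 1) choose Suc m) = (2 * m + 1) * ((2 * m) choose m)"
    using binomial_absorption[of m "2*m+1"] by (simp del: binomial_Suc_Suc)
  have "real (Suc m) * real (Suc m) * real ((2 * m + 2) choose Suc m)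
      = real (2 * m + 2) * real (2 * m + 1) * real ((2 * m) choose m)"
    using arg_cong[OF a, of real] arg_cong[OF b, of real] sym
    by (simp only: of_nat_mult mult.assoc) (metis mult.left_commute)
  hence "(real m + 1) * ((real m + 1) * real ((2 * m + 2) choose Suc m))
      = (real m + 1) * ((2 * (2 * real m + 1)) * real ((2 * m) choose m))"
    by (simp only: of_nat_add of_nat_mult of_nat_Suc of_nat_numeral of_nat_1) (simp only: algebra_simps)
  hence "(real m + 1) * real ((2 * m + 2) choose Suc m) = (2 * (2 * real m + 1)) * real ((2 * m) choose m)"
    by (subst (asm) mult_cancel_left) auto
  hence "real ((2 * m + 2) choose Suc m) = (2 * (2 * real m + 1)) * real ((2 * m) choose m) / (real m + 1)"
    by (metis add.commute add_cancel_left_right nonzero_mult_div_cancel_left of_nat_Suc of_nat_eq_0_iff Suc_neq_Zero)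
  hence "central (Suc m) = (2 * (2 * real m + 1)) * real ((2 * m) choose m) / (real m + 1) / (4 * 4 ^ m)"
    by (simp add: central_def del: binomial_Suc_Suc)
  also have "\<dots> = central m * (2 * real m + 1) / (2 * real m + 2)"
    unfolding central_def by (simp add: divide_simps) (simp add: algebra_simps)
  finally show ?thesis .
qed

text \<open>In each step \<open>(central m)\<^sup>2 * (2 * m + 1)\<close> and the Wallis product
  acquire reciprocal factors. Through \<open>wallis\<close> the identity determines the limit of
  \<open>m * (central m)\<^sup>2\<close>.\<close>

lemma central_wallis:
  "(central m)\<^sup>2 * (2 * real m + 1) * (\<Prod>k=1..m. (4 * real k ^ 2) / (4 * real k ^ 2 - 1)) = 1"
proof (induction m)
  case 0
  show ?case by (simp add: central_def)
next
  case (Suc m)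
  define W where "W = (\<Prod>k=1..m. (4 * real k ^ 2) / (4 * real k ^ 2 - 1))"
  have W: "(\<Prod>k=1..Suc m. (4 * real k ^ 2) / (4 * real k ^ 2 - 1))
    = W * ((2 * real m + 2)\<^sup>2 / ((2 * real m + 1) * (2 * real m + 3)))"
    unfolding W_def by (simp add: power2_eq_square algebra_simps)
  have "(central (Suc m))\<^sup>2 * (2 * real (Suc m) + 1) * (W * ((2 * real m + 2)\<^sup>2 / ((2 * real m + 1) * (2 * real m + 3))))
     = (central m)\<^sup>2 * W * ((2 * real m + 1)\<^sup>2 / (2 * real m + 2)\<^sup>2 * (2 * real m + 3) * ((2 * real m + 2)\<^sup>2 / ((2 * real m + 1) * (2 * real m + 3))))"
    unfolding central_Suc by (simp add: power_mult_distrib power_divide ac_simps)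
  also have "(2 * real m + 1)\<^sup>2 / (2 * real m + 2)\<^sup>2 * (2 * real m + 3) * ((2 * real m + 2)\<^sup>2 / ((2 * real m + 1) * (2 * real m + 3)))
     = 2 * real m + 1"
  proof -
    have "2 * real m + 1 \<noteq> 0" "2 * real m + 2 \<noteq> 0" "2 * real m + 3 \<noteq> 0"
      using of_nat_0_le_iff[of m, where 'a=real] by linarith+
    thus ?thesis by (simp add: power2_eq_square)
  qed
  also have "(central m)\<^sup>2 * W * (2 * real m + 1) = 1"
    using Suc unfolding W_def by (simp only: mult_ac)
  finally show ?case unfolding W .
qed

text \<open>Consecutive terms have ratio \<open>(2*m+1)\<^sup>2 / (4*m*(m+1))\<close>, which is at
  least 1. By monotonicity the limit bounds every term, so \<open>central_le\<close> carries no
  error term.\<close>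

lemma incseq_central: "incseq (\<lambda>m. real m * (central m)\<^sup>2)"
proof (rule incseq_SucI)
  fix m
  have "4 * real m * (real m + 1) \<le> (2 * real m + 1)\<^sup>2"
    by (simp add: power2_eq_square algebra_simps)
  hence "real m \<le> (real m + 1) * ((2 * real m + 1)\<^sup>2 / (2 * real m + 2)\<^sup>2)"
    by (simp add: power2_eq_square divide_simps) (simp add: algebra_simps)
  hence "real m * (central m)\<^sup>2 \<le> ((real m + 1) * ((2 * real m + 1)\<^sup>2 / (2 * real m + 2)\<^sup>2)) * (central m)\<^sup>2"
    by (rule mult_right_mono) simp
  thus "real m * (central m)\<^sup>2 \<le> real (Suc m) * (central (Suc m))\<^sup>2"
    unfolding central_Suc by (simp add: power_mult_distrib power_divide ac_simps)
qed

lemma central_le: assumes "m > 0" shows "central m \<le> sqrt (1 / (pi * real m))"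
proof -
  define W where "W = (\<lambda>m. \<Prod>k=1..m. (4 * real k ^ 2) / (4 * real k ^ 2 - 1))"
  \<comment> \<open>With \<open>W\<close> tending to pi/2 the quotient tends to 1/pi, and
    \<open>central_wallis\<close> identifies it with \<open>m * (central m)\<^sup>2\<close>.\<close>
  have "(\<lambda>m. real m / (2 * real m + 1)) \<longlonglongrightarrow> 1 / 2"
    by real_asymp
  moreover have "W \<longlonglongrightarrow> pi / 2" unfolding W_def by (rule wallis)
  ultimately have "(\<lambda>m. real m / (2 * real m + 1) / W m) \<longlonglongrightarrow> (1 / 2) / (pi / 2)"
    by (rule tendsto_divide) simp
  moreover have "real m / (2 * real m + 1) / W m = real m * (central m)\<^sup>2" for m
  proof -
    have w: "(central m)\<^sup>2 * (2 * real m + 1) * W m = 1"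
      using central_wallis[of m] by (simp add: W_def)
    hence "W m \<noteq> 0" by auto
    moreover have "2 * real m + 1 \<noteq> 0"
      using of_nat_0_le_iff[of m, where 'a=real] by linarith
    ultimately have "(central m)\<^sup>2 = 1 / ((2 * real m + 1) * W m)"
      using w by (simp add: nonzero_eq_divide_eq mult.assoc)
    thus ?thesis by simp
  qed
  ultimately have "(\<lambda>m. real m * (central m)\<^sup>2) \<longlonglongrightarrow> 1 / pi" by simp
  from incseq_le[OF incseq_central this] have "real m * (central m)\<^sup>2 \<le> 1 / pi" .
  hence "(central m)\<^sup>2 \<le> 1 / (pi * real m)" using assms by (simp add: field_simps)
  thus ?thesis by (rule real_le_rsqrt)
qed

section \<open>Binomial probabilities compared with the Gaussian density\<close>

definition binom_prob :: "nat \<Rightarrow> nat \<Rightarrow> real" where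
  "binom_prob n j = real (n choose j) / 2 ^ n"

lemma binom_prob_nonneg: "binom_prob n j \<ge> 0"
  by (simp add: binom_prob_def)

text \<open>The ratio of the two probabilities is
  \<open>(n - j) / (j + 1) = (1 - s) / (1 + s)\<close> for
  \<open>s = (2*j - n + 1) / (n + 1)\<close>, and
  \<open>(1 - s) / (1 + s) \<le> exp (- 2 * s)\<close>. These exponents add up exactly to a Gaussian
  exponent of variance \<open>n + 1\<close>.\<close>

lemma binom_prob_Suc_le:
  assumes "n \<le> 2 * j + 1" "j < n"
  shows "binom_prob n (Suc j) \<le> binom_prob n j * exp (- 2 * (2 * real j - real n + 1) / (real n + 1))"
proof -
  define s where "s = (2 * real j - real n + 1) / (real n + 1)"
  have s: "0 \<le> s" "s < 1" using assms by (auto simp: s_def field_simps)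
  have "(1 - s) / (1 + s) \<le> exp (- 2 * s)"
  proof -
    have d: "exp (2 * s) * (1 - s) \<le> 1 + s"
    proof -
      \<comment> \<open>The claim multiplied by \<open>exp (- s)\<close>: in this balanced form the
        difference vanishes at 0 and has derivative \<open>s * (exp s - exp (- s))\<close>.\<close>
      define h where "h = (\<lambda>s::real. (1 + s) * exp (- s) - (1 - s) * exp s)"
      have "h 0 \<le> h s"
      proof (rule DERIV_nonneg_imp_nondecreasing[OF s(1)])
        fix x :: real assume x: "0 \<le> x" "x \<le> s"
        have "(h has_real_derivative (x * (exp x - exp (- x)))) (at x)"
          unfolding h_def by (auto intro!: derivative_eq_intros simp: algebra_simps)
        moreover have "0 \<le> x * (exp x - exp (- x))" using x by simp
        ultimately show "\<exists>y. (h has_real_derivative y) (at x) \<and> 0 \<le> y" by blast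
      qed
      hence "(1 - s) * exp s \<le> (1 + s) * exp (- s)" by (simp add: h_def)
      hence "(1 - s) * exp s * exp s \<le> (1 + s) * exp (- s) * exp s"
        by (rule mult_right_mono) simp
      thus ?thesis by (simp add: mult.assoc flip: exp_add) (simp add: mult.commute)
    qed
    thus ?thesis using s by (simp add: exp_minus field_simps)
  qed
  moreover have "(1 - s) / (1 + s) = real (n - j) / real (Suc j)"
  proof -
    have p: "real n + 1 > 0" by simp
    have "1 - s = 2 * (real n - real j) / (real n + 1)" "1 + s = 2 * (real j + 1) / (real n + 1)"
      unfolding s_def using p by (simp_all add: field_simps)
    hence "(1 - s) / (1 + s) = 2 * (real n - real j) / (2 * (real j + 1))"
      using p by (simp only:) simp
    also have "\<dots> = (real n - real j) / (real j + 1)"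
      by (simp only: mult_divide_mult_cancel_left_if) simp
    finally show ?thesis using assms by (simp add: of_nat_diff add.commute)
  qed
  moreover have "binom_prob n (Suc j) = binom_prob n j * (real (n - j) / real (Suc j))"
  proof -
    have "Suc j * (n choose Suc j) = (n - j) * (n choose j)"
      using binomial_absorb_comp[of n j] binomial_absorption[of j n] by simp
    hence "real (Suc j) * real (n choose Suc j) = real (n - j) * real (n choose j)"
      by (metis of_nat_mult)
    thus ?thesis by (simp add: binom_prob_def field_simps del: of_nat_Suc)
  qed
  moreover have "- 2 * s = - 2 * (2 * real j - real n + 1) / (real n + 1)"
    by (simp add: s_def)
  ultimately show ?thesis
    by (simp only: mult_left_mono binom_prob_nonneg)
qed

text \<open>The middle index, rounded up, starts the induction of
  \<open>binom_prob_le_gaussian\<close>. Odd \<open>n = 2*m + 1\<close> reduces to the even case,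
  because the binomial coefficient of \<open>2*m + 2\<close> over \<open>m + 1\<close> is twice that
  of \<open>n\<close> over \<open>m + 1\<close>.\<close>

lemma binom_prob_half:
  assumes "n > 0"
  shows "binom_prob n ((n + 1) div 2) \<le> sqrt (2 / (pi * real n))"
proof (cases "even n")
  case True
  then obtain m where m: "n = 2 * m" by auto
  have "binom_prob n ((n + 1) div 2) = central m"
    by (simp add: m binom_prob_def central_def power_mult)
  thus ?thesis using central_le[of m] assms m by simp
next
  case False
  then obtain m where m: "n = 2 * m + 1" by (auto elim: oddE)
  have "((2 * m + 2) choose Suc m) = 2 * ((2 * m + 1) choose Suc m)"
    using binomial_symmetric[of m "2*m+1"] by simp
  hence "real ((2 * m + 2) choose Suc m) = 2 * real ((2 * m + 1) choose Suc m)"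
    by (simp only: of_nat_mult of_nat_numeral)
  hence "binom_prob n ((n + 1) div 2) = central (Suc m)"
    by (simp add: m binom_prob_def central_def power_mult del: binomial_Suc_Suc)
  also have "\<dots> \<le> sqrt (1 / (pi * real (Suc m)))" by (rule central_le) simp
  also have "\<dots> \<le> sqrt (2 / (pi * real n))" unfolding m
    by (intro real_sqrt_le_mono) (simp add: divide_simps)
  finally show ?thesis .
qed

text \<open>Induction upwards from the middle by \<open>binom_prob_Suc_le\<close>. The factor
  \<open>exp (1 / (2 * (n + 1)))\<close> pays for the base case, where \<open>2*j - n\<close> is 1
  if \<open>n\<close> is odd.\<close>

lemma binom_prob_le_gaussian:
  assumes "n > 0" "n \<le> 2 * j" "j \<le> n"
  shows "binom_prob n j \<le> sqrt (2 / (pi * real n)) * exp (1 / (2 * (real n + 1)))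
     * exp (- (2 * real j - real n)\<^sup>2 / (2 * (real n + 1)))"
proof -
  have "(n + 1) div 2 \<le> j" using assms by presburger
  thus ?thesis using assms(3)
  proof (induction j rule: dec_induct)
    case base
    have "2 * real ((n + 1) div 2) - real n \<in> {0, 1}"
      by (cases "even n") (auto elim!: evenE oddE)
    hence "(2 * real ((n + 1) div 2) - real n)\<^sup>2 \<le> 1" by auto
    hence "1 \<le> exp (1 / (2 * (real n + 1)) + - (2 * real ((n + 1) div 2) - real n)\<^sup>2 / (2 * (real n + 1)))"
      by (simp add: divide_simps)
    hence "sqrt (2 / (pi * real n)) * 1 \<le> sqrt (2 / (pi * real n)) * \<dots>"
      by (rule mult_left_mono) simp
    with binom_prob_half[OF assms(1)] show ?case
      by (simp only: exp_add mult.assoc mult_1_right)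
  next
    case (step j)
    have "binom_prob n (Suc j) \<le> binom_prob n j * exp (- 2 * (2 * real j - real n + 1) / (real n + 1))"
      using step by (intro binom_prob_Suc_le) auto
    also have "\<dots> \<le> (sqrt (2 / (pi * real n)) * exp (1 / (2 * (real n + 1)))
     * exp (- (2 * real j - real n)\<^sup>2 / (2 * (real n + 1)))) * exp (- 2 * (2 * real j - real n + 1) / (real n + 1))"
      using step by (intro mult_right_mono) auto
    also have "\<dots> = sqrt (2 / (pi * real n)) * exp (1 / (2 * (real n + 1)))
      * exp (- (2 * real j - real n)\<^sup>2 / (2 * (real n + 1)) + - 2 * (2 * real j - real n + 1) / (real n + 1))"
      by (simp only: exp_add mult.assoc)
    \<comment> \<open>With \<open>d = 2*j - n\<close> this is
      \<open>(d + 2)\<^sup>2 - d\<^sup>2 = 4 * (d + 1)\<close>.\<close>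
    also have "- (2 * real j - real n)\<^sup>2 / (2 * (real n + 1)) + - 2 * (2 * real j - real n + 1) / (real n + 1)
       = - (2 * real (Suc j) - real n)\<^sup>2 / (2 * (real n + 1))"
    proof -
      have "- 2 * (2 * real j - real n + 1) / (real n + 1) = - 4 * (2 * real j - real n + 1) / (2 * (real n + 1))"
        by (simp add: divide_simps) (simp add: algebra_simps)
      thus ?thesis by (simp only: add_divide_distrib[symmetric]) (simp add: power2_eq_square algebra_simps)
    qed
    finally show ?case .
  qed
qed

lemma binom_prob_symmetric: "j \<le> n \<Longrightarrow> binom_prob n j = binom_prob n (n - j)"
  using binomial_symmetric[of j n] by (simp add: binom_prob_def)

lemma sum_binom_prob: "(\<Sum>j\<le>n. binom_prob n j) = 1"
proof -
  have "(\<Sum>j\<le>n. real (n choose j)) = 2 ^ n"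
    using arg_cong[OF choose_row_sum[of n], of real] by simp
  thus ?thesis by (simp add: binom_prob_def flip: sum_divide_distrib)
qed

section \<open>Gaussian tails\<close>

lemma integrable_tail: "integrable lborel (\<lambda>s. indicator {x..} s * std_normal_density s)"
  using integrable_real_mult_indicator[OF _ integrable_normal_density[of 1 0], of "{x..}"]
  by (simp add: mult.commute)

lemma tail_eq: "tail x = (\<integral>s. indicator {x..} s * std_normal_density s \<partial>lborel)"
  unfolding tail_def set_lebesgue_integral_def std_normal_density_def
  by (subst Bochner_Integration.integral_mult_right_zero[symmetric])
    (intro Bochner_Integration.integral_cong, auto simp: indicator_def)

lemma tail_nonneg: "0 \<le> tail x"
  unfolding tail_eq by (intro Bochner_Integration.integral_nonneg) auto

lemma tail_antimono: "x \<le> y \<Longrightarrow> tail y \<le> tail x"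
  unfolding tail_eq
  by (intro integral_mono integrable_tail) (auto simp: indicator_def)

lemma std_normal_density_antimono:
  "0 \<le> s \<Longrightarrow> s \<le> t \<Longrightarrow> std_normal_density t \<le> std_normal_density s"
  unfolding std_normal_density_def by (intro mult_left_mono) (auto intro: power_mono)

text \<open>The density decreases on \<open>[x, y]\<close>, so its value at \<open>y\<close> bounds
  it from below there. This turns single binomial probabilities into tail differences, which
  telescope.\<close>

lemma tail_diff_ge:
  assumes "0 \<le> x" "x \<le> y"
  shows "(y - x) * std_normal_density y \<le> tail x - tail y"
proof -
  have "(y - x) * std_normal_density y = (\<integral>s. indicator {x..<y} s * std_normal_density y \<partial>lborel)"
    using assms by simp
  also have "\<dots> \<le> (\<integral>s. indicator {x..} s * std_normal_density s - indicator {y..} s * std_normal_density s \<partial>lborel)"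
  proof (rule integral_mono)
    show "integrable lborel (\<lambda>s. indicator {x..<y} s * std_normal_density y)"
      using assms by simp
    show "integrable lborel (\<lambda>s. indicator {x..} s * std_normal_density s - indicator {y..} s * std_normal_density s)"
      by (intro Bochner_Integration.integrable_diff integrable_tail)
    show "indicator {x..<y} s * std_normal_density y
        \<le> indicator {x..} s * std_normal_density s - indicator {y..} s * std_normal_density s" for s
      using std_normal_density_antimono[of s y] assms by (auto simp: indicator_def)
  qed
  also have "\<dots> = tail x - tail y"
    unfolding tail_eq by (intro Bochner_Integration.integral_diff integrable_tail)
  finally show ?thesis .
qed

lemma tail_pos: "0 \<le> x \<Longrightarrow> 0 < tail x"
  using tail_diff_ge[of x "x+1"] tail_nonneg[of "x+1"] normal_density_pos[of 1 0 "x+1"] by simp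

text \<open>After translation by \<open>d\<close>, the exponent satisfies
  \<open>- (d + s)\<^sup>2 / 2 \<le> - x * d - s\<^sup>2 / 2\<close> for \<open>s \<ge> x\<close>.
  The gain \<open>exp (- x * d)\<close> later compensates the multiplicative error of the Gaussian
  comparison.\<close>

lemma tail_shift:
  assumes "0 \<le> d"
  shows "tail (x + d) \<le> exp (- x * d) * tail x"
proof -
  have "tail (x + d) = (\<integral>s. indicator {x+d..} (d + 1 * s) * std_normal_density (d + 1 * s) \<partial>lborel)"
    unfolding tail_eq by (subst lborel_integral_real_affine[of 1 _ d]) auto
  also have "\<dots> \<le> (\<integral>s. exp (- x * d) * (indicator {x..} s * std_normal_density s) \<partial>lborel)"
  proof (rule integral_mono)
    show "integrable lborel (\<lambda>s. indicator {x+d..} (d + 1 * s) * std_normal_density (d + 1 * s))"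
      by (rule lborel_integrable_real_affine[OF integrable_tail]) simp
    show "integrable lborel (\<lambda>s. exp (- x * d) * (indicator {x..} s * std_normal_density s))"
      by (intro integrable_mult_right integrable_tail)
    show "indicator {x+d..} (d + 1 * s) * std_normal_density (d + 1 * s)
        \<le> exp (- x * d) * (indicator {x..} s * std_normal_density s)" for s
    proof (cases "x \<le> s")
      case True
      have "x * d \<le> s * d" using True assms by (rule mult_right_mono)
      moreover have "0 \<le> d * d" by simp
      moreover have "- (d + s)\<^sup>2 / 2 = - (d * d) / 2 - s * d + - s\<^sup>2 / 2"
        by (simp add: power2_eq_square field_simps)
      ultimately have "- (d + s)\<^sup>2 / 2 \<le> - (x * d) + - s\<^sup>2 / 2"
        by linarith
      hence "exp (- (d + s)\<^sup>2 / 2) \<le> exp (- (x * d)) * exp (- s\<^sup>2 / 2)"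
        by (simp add: mult_exp_exp)
      from mult_left_mono[OF this, of "1 / sqrt (2 * pi)"] True show ?thesis
        unfolding std_normal_density_def by (simp add: indicator_def mult_ac)
    qed (simp add: indicator_def)
  qed
  also have "\<dots> = exp (- x * d) * tail x"
    unfolding tail_eq by (rule Bochner_Integration.integral_mult_right_zero)
  finally show ?thesis .
qed

text \<open>Neighbouring values of \<open>2*j - n\<close> are 2 apart, that is
  \<open>2 / sqrt (n + 1)\<close> after scaling. The density at the right end of such an interval is
  bounded by the Gaussian mass of the interval, hence the tail starts one lattice step early, at
  \<open>2*j - n - 2\<close>.\<close>

lemma binom_prob_le_tail_diff:
  assumes "n > 0" "n + 2 \<le> 2 * j" "j \<le> n"
  shows "binom_prob n j \<le> sqrt ((real n + 1) / real n) * exp (1 / (2 * (real n + 1)))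
     * (tail ((2 * real j - real n - 2) / sqrt (real n + 1)) - tail ((2 * real j - real n) / sqrt (real n + 1)))"
proof -
  define \<sigma> d where "\<sigma> = sqrt (real n + 1)" and "d = 2 * real j - real n"
  have s: "\<sigma> > 0" "\<sigma>\<^sup>2 = real n + 1" by (auto simp: \<sigma>_def)
  have d: "d \<ge> 2" using assms unfolding d_def by linarith
  have "(2 / \<sigma>) * std_normal_density (d / \<sigma>) \<le> tail ((d - 2) / \<sigma>) - tail (d / \<sigma>)"
    using tail_diff_ge[of "(d - 2) / \<sigma>" "d / \<sigma>"] d s
    by (simp add: divide_right_mono diff_divide_distrib)
  hence "\<sigma> / 2 * ((2 / \<sigma>) * std_normal_density (d / \<sigma>)) \<le> \<sigma> / 2 * (tail ((d - 2) / \<sigma>) - tail (d / \<sigma>))"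
    by (rule mult_left_mono) (use s in simp)
  hence le: "std_normal_density (d / \<sigma>) \<le> \<sigma> / 2 * (tail ((d - 2) / \<sigma>) - tail (d / \<sigma>))"
    using s by simp
  have "binom_prob n j \<le> sqrt (2 / (pi * real n)) * exp (1 / (2 * (real n + 1)))
     * exp (- d\<^sup>2 / (2 * (real n + 1)))"
    unfolding d_def using assms by (intro binom_prob_le_gaussian) auto
  also have "exp (- d\<^sup>2 / (2 * (real n + 1))) = sqrt (2 * pi) * std_normal_density (d / \<sigma>)"
    by (simp add: std_normal_density_def power_divide s mult.commute)
  also have "sqrt (2 / (pi * real n)) * exp (1 / (2 * (real n + 1))) * (sqrt (2 * pi) * std_normal_density (d / \<sigma>))
    \<le> sqrt (2 / (pi * real n)) * exp (1 / (2 * (real n + 1))) * (sqrt (2 * pi) * (\<sigma> / 2 * (tail ((d - 2) / \<sigma>) - tail (d / \<sigma>))))"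
    by (intro mult_left_mono le) auto
  also have "\<dots> = (sqrt (2 / (pi * real n)) * sqrt (2 * pi) * \<sigma> / 2) * exp (1 / (2 * (real n + 1)))
      * (tail ((d - 2) / \<sigma>) - tail (d / \<sigma>))"
    by simp
  also have "sqrt (2 / (pi * real n)) * sqrt (2 * pi) * \<sigma> / 2 = sqrt ((real n + 1) / real n)"
  proof -
    have "sqrt (2 / (pi * real n)) * sqrt (2 * pi) = sqrt (4 / real n)"
      by (simp add: real_sqrt_mult[symmetric])
    thus ?thesis by (simp add: \<sigma>_def real_sqrt_divide)
  qed
  finally show ?thesis unfolding \<sigma>_def d_def .
qed

lemma sum_binom_prob_le_tail:
  assumes "n > 0" "a \<ge> 2"
  shows "(\<Sum>j | j \<le> n \<and> a \<le> 2 * real j - real n. binom_prob n j)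
     \<le> sqrt ((real n + 1) / real n) * exp (1 / (2 * (real n + 1))) * tail ((a - 2) / sqrt (real n + 1))"
    (is "_ \<le> ?K * _")
proof -
  define j0 where "j0 = nat \<lceil>(real n + a) / 2\<rceil>"
  \<comment> \<open>The sign makes \<open>F (Suc j) - F j\<close> the tail difference belonging to
    \<open>j\<close>, so the sum telescopes.\<close>
  define F where "F = (\<lambda>j. - tail ((2 * real j - real n - 2) / sqrt (real n + 1)))"
  have j0: "j0 \<le> j \<longleftrightarrow> a \<le> 2 * real j - real n" for j
    unfolding j0_def by (simp add: nat_le_iff ceiling_le_iff) linarith
  have K: "0 \<le> ?K" by simp
  have set: "{j. j \<le> n \<and> a \<le> 2 * real j - real n} = {j0..n}"
    unfolding j0[symmetric] by auto
  show ?thesis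
  proof (cases "j0 \<le> n")
    case True
    have "(\<Sum>j=j0..n. binom_prob n j) \<le> (\<Sum>j=j0..n. ?K * (F (Suc j) - F j))"
    proof (rule sum_mono)
      fix j assume "j \<in> {j0..n}"
      hence "a \<le> 2 * real j - real n" "j \<le> n" using j0 by auto
      hence "n + 2 \<le> 2 * j" using assms by linarith
      thus "binom_prob n j \<le> ?K * (F (Suc j) - F j)"
        using binom_prob_le_tail_diff[of n j] assms \<open>j \<le> n\<close> by (simp add: F_def algebra_simps)
    qed
    also have "\<dots> = ?K * (F (Suc n) - F j0)"
      using True by (simp only: sum_distrib_left[symmetric] sum_Suc_diff[of j0 n F])
    also have "\<dots> \<le> ?K * tail ((a - 2) / sqrt (real n + 1))"
    proof (rule mult_left_mono[OF _ K])
      have "tail ((2 * real j0 - real n - 2) / sqrt (real n + 1)) \<le> tail ((a - 2) / sqrt (real n + 1))"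
        using j0[of j0] by (intro tail_antimono divide_right_mono) auto
      thus "F (Suc n) - F j0 \<le> tail ((a - 2) / sqrt (real n + 1))"
        using tail_nonneg[of "(2 * real (Suc n) - real n - 2) / sqrt (real n + 1)"] unfolding F_def by linarith
    qed
    finally show ?thesis unfolding set .
  next
    case False
    thus ?thesis unfolding set using K tail_nonneg[of "(a - 2) / sqrt (real n + 1)"] by simp
  qed
qed

lemma sum_binom_prob_le_tail_shifted:
  assumes "T \<ge> 1"
  shows "\<forall>\<^sub>F n in sequentially.
    (\<Sum>j | j \<le> n \<and> T * sqrt (real n) + 5 \<le> 2 * real j - real n. binom_prob n j) \<le> tail T"
proof -
  have "\<forall>\<^sub>F n in sequentially. T * sqrt (real n) + 3 \<ge> (T + 1 / sqrt (real n)) * sqrt (real n + 1)"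
    by real_asymp
  moreover have "\<forall>\<^sub>F n in sequentially. n > (0::nat)" by (rule eventually_gt_at_top)
  ultimately show ?thesis
  proof eventually_elim
    case (elim n)
    \<comment> \<open>Of the surplus 5, one lattice step takes 2; the other 3 absorb the variance
      \<open>n + 1\<close> in place of \<open>n\<close> and still leave an argument of at least
      \<open>T + 1 / sqrt n\<close>. By \<open>tail_shift\<close> this yields a factor
      \<open>exp (- T / sqrt n)\<close>, which outweighs the error factor
      \<open>exp (1 / n)\<close>.\<close>
    define a where "a = T * sqrt (real n) + 5"
    have n: "real n > 0" using elim by simp
    have "0 \<le> T * sqrt (real n)" using assms by simp
    hence a2: "a \<ge> 2" unfolding a_def by linarith
    have "T + 1 / sqrt (real n) \<le> (a - 2) / sqrt (real n + 1)"
      using elim by (simp add: a_def pos_le_divide_eq)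
    hence t: "tail ((a - 2) / sqrt (real n + 1)) \<le> exp (- T * (1 / sqrt (real n))) * tail T"
      using tail_antimono tail_shift[of "1 / sqrt (real n)" T] by (meson order_trans of_nat_0_le_iff real_sqrt_ge_zero zero_le_divide_1_iff)
    have K: "sqrt ((real n + 1) / real n) * exp (1 / (2 * (real n + 1))) \<le> exp (1 / real n)"
    proof -
      have "(real n + 1) / real n \<le> exp (1 / real n)"
        using exp_ge_add_one_self[of "1 / real n"] n by (simp add: add_divide_distrib add.commute)
      hence "sqrt ((real n + 1) / real n) \<le> sqrt (exp (1 / real n))" by simp
      also have "sqrt (exp (1 / real n)) = exp (1 / (2 * real n))"
        by (rule real_sqrt_unique) (simp_all add: power2_eq_square mult_exp_exp field_simps)
      finally have "sqrt ((real n + 1) / real n) * exp (1 / (2 * (real n + 1))) \<le> exp (1 / (2 * real n)) * exp (1 / (2 * real n))"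
        using n by (intro mult_mono) (auto simp: frac_le)
      also have "\<dots> = exp (1 / real n)" by (simp add: mult_exp_exp field_simps)
      finally show ?thesis .
    qed
    have "(\<Sum>j | j \<le> n \<and> a \<le> 2 * real j - real n. binom_prob n j)
       \<le> sqrt ((real n + 1) / real n) * exp (1 / (2 * (real n + 1))) * tail ((a - 2) / sqrt (real n + 1))"
      using elim a2 by (intro sum_binom_prob_le_tail) auto
    also have "\<dots> \<le> exp (1 / real n) * (exp (- T * (1 / sqrt (real n))) * tail T)"
      using K t tail_nonneg by (intro mult_mono) auto
    also have "\<dots> = exp (1 / real n - T / sqrt (real n)) * tail T"
      by (simp add: mult_exp_exp flip: mult.assoc)
    also have "\<dots> \<le> 1 * tail T"
    proof (rule mult_right_mono[OF _ tail_nonneg])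
      have "1 / real n \<le> 1 / sqrt (real n)"
        using n elim by (intro divide_left_mono) (auto simp: real_sqrt_le_iff intro!: real_le_lsqrt power_increasing[of 1 2 "real n", simplified])
      also have "\<dots> \<le> T / sqrt (real n)" using assms by (intro divide_right_mono) auto
      finally show "exp (1 / real n - T / sqrt (real n)) \<le> 1" by simp
    qed
    finally show ?case unfolding a_def by simp
  qed
qed

text \<open>The band \<open>\<bar>2*j - n\<bar> < sqrt n\<close> contains at most
  \<open>sqrt n + 1\<close> indices, each of probability at most \<open>q\<close>, so its mass is
  eventually at most 0.84; by symmetry the upper side gets half of the rest. This later ensures that
  a correct protocol outputs 1 with constant probability.\<close>

lemma sum_binom_prob_ge:
  "\<forall>\<^sub>F n in sequentially. (8::real) / 100 \<le> (\<Sum>j | j \<le> n \<and> sqrt (real n) \<le> 2 * real j - real n. binom_prob n j)"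
proof -
  have "\<forall>\<^sub>F n in sequentially. (sqrt (real n) + 1) * (sqrt (2 / (3 * real n)) * exp (1 / (2 * (real n + 1)))) \<le> 84 / 100"
  proof -
    have "(\<lambda>n. (sqrt (real n) + 1) * (sqrt (2 / (3 * real n)) * exp (1 / (2 * (real n + 1))))) \<longlonglongrightarrow> sqrt (2 / 3)"
      by (real_asymp simp: powr_half_sqrt)
    \<comment> \<open>The limit is \<open>sqrt (2/3)\<close> because \<open>q\<close> has 3 in place
      of pi.\<close>
    moreover have "sqrt (2 / 3) < 84 / 100" by (rule real_less_lsqrt) (auto simp: power2_eq_square)
    ultimately show ?thesis
      using order_tendstoD(2) by (fast elim: eventually_mono order.strict_implies_order)
  qed
  moreover have "\<forall>\<^sub>F n in sequentially. n > (0::nat)" by (rule eventually_gt_at_top)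
  ultimately show ?thesis
  proof eventually_elim
    case (elim n)
    define q where "q = sqrt (2 / (3 * real n)) * exp (1 / (2 * (real n + 1)))"
    define A where "A = {j. j \<le> n \<and> sqrt (real n) \<le> 2 * real j - real n}"
    define B where "B = {j. j \<le> n \<and> \<bar>2 * real j - real n\<bar> < sqrt (real n)}"
    define C where "C = {j. j \<le> n \<and> 2 * real j - real n \<le> - sqrt (real n)}"
    have q0: "q \<ge> 0" by (simp add: q_def)
    have q1: "binom_prob n j \<le> q" if "n \<le> 2 * j" "j \<le> n" for j
    proof -
      have "binom_prob n j \<le> sqrt (2 / (pi * real n)) * exp (1 / (2 * (real n + 1)))
        * exp (- (2 * real j - real n)\<^sup>2 / (2 * (real n + 1)))"
        using that elim by (intro binom_prob_le_gaussian) auto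
      also have "\<dots> \<le> q * 1"
        unfolding q_def using pi_gt3 elim by (intro mult_mono) (auto intro!: frac_le)
      finally show ?thesis by simp
    qed
    have q2: "binom_prob n j \<le> q" if "j \<le> n" for j
      using q1[of j] q1[of "n - j"] binom_prob_symmetric[OF that] that
      by (cases "n \<le> 2 * j") auto
    have fin: "finite A" "finite B" "finite C" by (auto simp: A_def B_def C_def)
    have sC: "sum (binom_prob n) C = sum (binom_prob n) A"
      unfolding A_def C_def
      by (rule sum.reindex_bij_witness[of _ "\<lambda>j. n - j" "\<lambda>j. n - j"])
        (auto simp: of_nat_diff intro: binom_prob_symmetric[symmetric])
    have "{..n} = A \<union> B \<union> C" by (auto simp: A_def B_def C_def abs_less_iff) 
    moreover have "A \<inter> B = {}" "(A \<union> B) \<inter> C = {}"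
    proof -
      have "sqrt (real n) > 0" using elim by simp
      hence "\<not> (sqrt (real n) \<le> d \<and> d \<le> - sqrt (real n))" for d by linarith
      thus "A \<inter> B = {}" "(A \<union> B) \<inter> C = {}" by (auto simp: A_def B_def C_def)
    qed
    ultimately have "1 = sum (binom_prob n) A + sum (binom_prob n) B + sum (binom_prob n) C"
      using sum_binom_prob[of n] fin by (simp add: sum.union_disjoint)
    moreover have "sum (binom_prob n) B \<le> (sqrt (real n) + 1) * q"
    proof -
      define l where "l = (real n - sqrt (real n)) / 2"
      have "B \<subseteq> nat ` {\<lfloor>l\<rfloor> + 1..\<lceil>l + sqrt (real n)\<rceil> - 1}"
      proof
        fix j assume "j \<in> B"
        hence "l < real j" "real j < l + sqrt (real n)" by (auto simp: B_def l_def field_simps)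
        hence "\<lfloor>l\<rfloor> + 1 \<le> int j" "int j \<le> \<lceil>l + sqrt (real n)\<rceil> - 1" by linarith+
        thus "j \<in> nat ` {\<lfloor>l\<rfloor> + 1..\<lceil>l + sqrt (real n)\<rceil> - 1}" by (force intro: image_eqI[of _ _ "int j"])
      qed
      hence "card B \<le> card (nat ` {\<lfloor>l\<rfloor> + 1..\<lceil>l + sqrt (real n)\<rceil> - 1})" by (intro card_mono) auto
      also have "\<dots> \<le> card {\<lfloor>l\<rfloor> + 1..\<lceil>l + sqrt (real n)\<rceil> - 1}" by (rule card_image_le) simp
      also have "\<dots> = nat (\<lceil>l + sqrt (real n)\<rceil> - 1 - \<lfloor>l\<rfloor>)" by simp
      finally have "real (card B) \<le> sqrt (real n) + 1"
        using real_sqrt_ge_zero[of "real n"] by linarith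
      moreover have "sum (binom_prob n) B \<le> real (card B) * q"
        using q2 by (intro sum_bounded_above) (auto simp: B_def)
      ultimately show ?thesis using q0 by (meson mult_right_mono order_trans)
    qed
    ultimately show ?case using elim sC unfolding q_def A_def by linarith
  qed
qed

section \<open>Rectangles for GHD and ORT\<close>

lemma cube_0: "cube 0 = {[]}"
  by (auto simp: cube_def)

lemma cube_Suc: "cube (Suc n) = (#) 1 ` cube n \<union> (#) (-1) ` cube n"
  by (auto simp: cube_def length_Suc_conv)

lemma finite_cube [simp]: "finite (cube n)"
  by (induction n) (auto simp: cube_0 cube_Suc)

lemma sum_cube_Suc:
  fixes F :: "int list \<Rightarrow> real"
  shows "sum F (cube (Suc n)) = (\<Sum>x\<in>cube n. F (1 # x)) + (\<Sum>x\<in>cube n. F ((-1) # x))"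
  unfolding cube_Suc by (subst sum.union_disjoint) (auto simp: sum.reindex)

lemma card_cube: "card (cube n) = 2 ^ n"
proof (induction n)
  case (Suc n)
  have "real (card (cube (Suc n))) = real (2 ^ Suc n)"
    using sum_cube_Suc[of "\<lambda>_. 1" n] Suc by simp
  thus ?case by (simp only: of_nat_eq_iff)
qed (simp add: cube_0)

lemma cube_nonempty: "cube n \<noteq> {}"
  using card_cube[of n] by force

lemma ip_Cons: "ip (Suc n) (a # x) (b # y) = a * b + ip n x y"
  unfolding ip_def by (simp add: sum.lessThan_Suc_shift del: sum.lessThan_Suc)

text \<open>Here \<open>j\<close> counts the positions where \<open>x\<close> and \<open>y\<close>
  agree. Splitting off the first coordinates shifts the argument of \<open>F\<close> by 1 or -1,
  which is why \<open>F\<close> is general in the induction; Pascal's rule recombines the two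
  sums.\<close>

lemma sum_ip:
  fixes F :: "int \<Rightarrow> real"
  shows "(\<Sum>x\<in>cube n. \<Sum>y\<in>cube n. F (ip n x y)) = 2 ^ n * (\<Sum>j\<le>n. real (n choose j) * F (2 * int j - int n))"
proof (induction n arbitrary: F)
  case 0
  show ?case by (simp add: cube_0 ip_def)
next
  case (Suc n)
  have "(\<Sum>x\<in>cube (Suc n). \<Sum>y\<in>cube (Suc n). F (ip (Suc n) x y))
     = 2 * ((\<Sum>x\<in>cube n. \<Sum>y\<in>cube n. F (ip n x y + 1)) + (\<Sum>x\<in>cube n. \<Sum>y\<in>cube n. F (ip n x y - 1)))"
    by (simp add: sum_cube_Suc ip_Cons sum.distrib algebra_simps)
  also have "\<dots> = 2 ^ Suc n * ((\<Sum>j\<le>n. real (n choose j) * F (2 * int j - int n + 1)) + (\<Sum>j\<le>n. real (n choose j) * F (2 * int j - int n - 1)))"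
    unfolding Suc[of "\<lambda>i. F (i + 1)"] Suc[of "\<lambda>i. F (i - 1)"] by (simp add: algebra_simps)
  also have "(\<Sum>j\<le>n. real (n choose j) * F (2 * int j - int n + 1)) + (\<Sum>j\<le>n. real (n choose j) * F (2 * int j - int n - 1))
     = (\<Sum>j\<le>Suc n. real (Suc n choose j) * F (2 * int j - int (Suc n)))"
  proof -
    define G where "G = (\<lambda>j. F (2 * int j - int (Suc n)))"
    have "(\<Sum>j\<le>Suc n. real (Suc n choose j) * G j)
        = G 0 + (\<Sum>j\<le>n. real (Suc n choose Suc j) * G (Suc j))"
      by (subst sum.atMost_Suc_shift) simp
    also have "\<dots> = (\<Sum>j\<le>n. real (n choose j) * G (Suc j)) + (G 0 + (\<Sum>j\<le>n. real (n choose Suc j) * G (Suc j)))"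
      by (simp add: sum.distrib algebra_simps)
    also have "G 0 + (\<Sum>j\<le>n. real (n choose Suc j) * G (Suc j)) = (\<Sum>j\<le>Suc n. real (n choose j) * G j)"
      by (subst sum.atMost_Suc_shift) simp
    also have "\<dots> = (\<Sum>j\<le>n. real (n choose j) * G j)" by simp
    finally show ?thesis by (simp add: G_def algebra_simps)
  qed
  finally show ?case .
qed

lemma set_pmf_\<mu>: "set_pmf (\<mu> n) = cube n \<times> cube n"
  unfolding \<mu>_def by (rule set_pmf_of_set) (auto simp: cube_nonempty)

lemma pmf_\<mu>: "pmf (\<mu> n) p = indicator (cube n \<times> cube n) p / 4 ^ n"
proof -
  have "card (cube n \<times> cube n) = 4 ^ n"
    by (simp add: card_cartesian_product card_cube flip: power_mult_distrib)
  thus ?thesis unfolding \<mu>_def by (subst pmf_of_set) (auto simp: cube_nonempty)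
qed

lemma prob_\<mu>: "measure_pmf.prob (\<mu> n) S = real (card (S \<inter> (cube n \<times> cube n))) / 4 ^ n"
proof -
  have "card (cube n \<times> cube n) = 4 ^ n"
    by (simp add: card_cartesian_product card_cube flip: power_mult_distrib)
  thus ?thesis unfolding \<mu>_def by (subst measure_pmf_of_set) (auto simp: cube_nonempty Int_commute)
qed

lemma prob_\<mu>_ip:
  "measure_pmf.prob (\<mu> n) {(x, y). Q (ip n x y)} = (\<Sum>j | j \<le> n \<and> Q (2 * int j - int n). binom_prob n j)"
proof -
  have "real (card ({(x, y). Q (ip n x y)} \<inter> (cube n \<times> cube n)))
      = (\<Sum>p\<in>cube n \<times> cube n. if Q (ip n (fst p) (snd p)) then 1 else 0)"
    by (simp add: sum.If_cases case_prod_unfold Int_commute)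
  also have "\<dots> = (\<Sum>x\<in>cube n. \<Sum>y\<in>cube n. (if Q (ip n x y) then 1 else 0))"
    by (simp add: sum.cartesian_product case_prod_unfold)
  also have "\<dots> = 2 ^ n * (\<Sum>j\<le>n. real (n choose j) * (if Q (2 * int j - int n) then 1 else 0))"
    by (rule sum_ip)
  also have "(\<Sum>j\<le>n. real (n choose j) * (if Q (2 * int j - int n) then 1 else 0))
     = (\<Sum>j | j \<le> n \<and> Q (2 * int j - int n). real (n choose j))"
    by (rule sum.mono_neutral_cong_right) auto
  finally have "measure_pmf.prob (\<mu> n) {(x, y). Q (ip n x y)}
     = (2 ^ n / 4 ^ n) * (\<Sum>j | j \<le> n \<and> Q (2 * int j - int n). real (n choose j))"
    by (simp add: prob_\<mu>)
  also have "(2 ^ n / 4 ^ n :: real) = 1 / 2 ^ n"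
    by (simp add: field_simps flip: power_mult_distrib)
  finally show ?thesis by (simp add: binom_prob_def sum_divide_distrib)
qed

section \<open>Corruption bounds as maxima over rectangles\<close>

lemma finite_rectangle_probs:
  assumes "finite X" "finite Y"
  shows "finite {measure_pmf.prob \<nu> (S1 \<times> S2) | S1 S2. S1 \<subseteq> X \<and> S2 \<subseteq> Y \<and> monochromatic \<nu> \<epsilon> z g (S1 \<times> S2)}"
proof (rule finite_subset)
  show "{measure_pmf.prob \<nu> (S1 \<times> S2) | S1 S2. S1 \<subseteq> X \<and> S2 \<subseteq> Y \<and> monochromatic \<nu> \<epsilon> z g (S1 \<times> S2)}
      \<subseteq> (\<lambda>(S1, S2). measure_pmf.prob \<nu> (S1 \<times> S2)) ` (Pow X \<times> Pow Y)"
    by auto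
qed (use assms in auto)

text \<open>Every admissible rectangle competes in the maximum, and the positive bound
  \<open>p\<close> rules out the value infinity.\<close>

lemma cb_le:
  assumes "finite X" "finite Y" "S1 \<subseteq> X" "S2 \<subseteq> Y" "monochromatic \<nu> \<epsilon> z g (S1 \<times> S2)"
    and "0 < p" "p \<le> measure_pmf.prob \<nu> (S1 \<times> S2)"
  shows "cb X Y z \<nu> \<epsilon> g \<le> ereal (- log 2 p)"
proof -
  define A where "A = {measure_pmf.prob \<nu> (S1 \<times> S2) | S1 S2. S1 \<subseteq> X \<and> S2 \<subseteq> Y \<and> monochromatic \<nu> \<epsilon> z g (S1 \<times> S2)}"
  have "measure_pmf.prob \<nu> (S1 \<times> S2) \<in> A" unfolding A_def using assms by blast
  hence "measure_pmf.prob \<nu> (S1 \<times> S2) \<le> Max A"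
    unfolding A_def using assms by (intro Max_ge finite_rectangle_probs)
  hence le: "p \<le> Max A" using assms by simp
  hence "log 2 p \<le> log 2 (Max A)" "Max A \<noteq> 0" using assms by auto
  thus ?thesis unfolding cb_def A_def[symmetric] by (simp add: Let_def)
qed

text \<open>A maximum over a finite nonempty family is attained; finiteness of \<open>cb\<close>
  excludes measure 0.\<close>

lemma cb_attained:
  assumes "finite X" "finite Y" "cb X Y z \<nu> \<epsilon> g \<noteq> \<infinity>"
  obtains S1 S2 where "S1 \<subseteq> X" "S2 \<subseteq> Y" "monochromatic \<nu> \<epsilon> z g (S1 \<times> S2)"
    "0 < measure_pmf.prob \<nu> (S1 \<times> S2)" "cb X Y z \<nu> \<epsilon> g = ereal (- log 2 (measure_pmf.prob \<nu> (S1 \<times> S2)))"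
proof -
  define A where "A = {measure_pmf.prob \<nu> (S1 \<times> S2) | S1 S2. S1 \<subseteq> X \<and> S2 \<subseteq> Y \<and> monochromatic \<nu> \<epsilon> z g (S1 \<times> S2)}"
  have "measure_pmf.prob \<nu> ({} \<times> {}) \<in> A"
    unfolding A_def by (rule CollectI, intro exI[of _ "{}"]) (simp add: monochromatic_def)
  hence "A \<noteq> {}" by auto
  hence "Max A \<in> A" unfolding A_def using assms by (intro Max_in finite_rectangle_probs)
  then obtain S1 S2 where S: "Max A = measure_pmf.prob \<nu> (S1 \<times> S2)" "S1 \<subseteq> X" "S2 \<subseteq> Y"
      "monochromatic \<nu> \<epsilon> z g (S1 \<times> S2)"
    unfolding A_def by auto
  have "Max A \<noteq> 0" "cb X Y z \<nu> \<epsilon> g = ereal (- log 2 (Max A))"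
    using assms(3) unfolding cb_def A_def[symmetric] by (auto simp: Let_def split: if_splits)
  moreover have "Max A \<ge> 0" unfolding S by simp
  ultimately show ?thesis using S that by (metis order_le_less)
qed

lemma cb_le_scb:
  assumes "finite X" "finite Y" "finite Z" "g \<in> X \<times> Y \<rightarrow>\<^sub>E insert None (Some ` Z)"
    "measure_pmf.prob \<nu> {p. f p \<noteq> g p} \<le> \<delta>"
  shows "cb X Y z \<nu> \<epsilon> g \<le> scb X Y Z z \<nu> \<epsilon> \<delta> f"
proof -
  have "finite (X \<times> Y \<rightarrow>\<^sub>E insert None (Some ` Z))" using assms by (intro finite_PiE) auto
  thus ?thesis unfolding scb_def using assms by (intro Max_ge) auto
qed

section \<open>Padding: from GHD to ORT\<close>

definition pad :: "nat \<Rightarrow> int \<Rightarrow> int list \<Rightarrow> int list" where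
  "pad k a x = x @ replicate k a"

lemma inj_pad: "inj (pad k a)"
  by (auto simp: pad_def inj_def)

lemma pad_in_cube: "x \<in> cube n \<Longrightarrow> a \<in> {-1, 1} \<Longrightarrow> pad k a x \<in> cube (n + k)"
  by (auto simp: cube_def pad_def)

lemma ip_pad:
  assumes "x \<in> cube n" "y \<in> cube n"
  shows "ip (n + k) (pad k 1 x) (pad k (-1) y) = ip n x y - int k"
  using assms
proof (induction n arbitrary: x y)
  case 0
  thus ?case by (simp add: cube_0 ip_def pad_def)
next
  case (Suc n)
  then obtain a x' b y' where "x = a # x'" "y = b # y'" "x' \<in> cube n" "y' \<in> cube n"
    unfolding cube_Suc by blast
  thus ?case using Suc.IH[of x' y'] by (simp add: pad_def ip_Cons)
qed

lemma card_pad_rectangle: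
  "card ((\<lambda>(x, y). (pad k a x, pad k a' y)) ` S) = card S"
  by (intro card_image inj_onI) (auto dest: injD[OF inj_pad])

text \<open>Padding maps an optimal rectangle for \<open>g\<close> injectively onto a rectangle of
  the larger cubes. Measures of its subsets all shrink by \<open>4 ^ k\<close>, so the error ratio
  does not grow, and \<open>- log 2\<close> of the measure increases by
  \<open>2 * k\<close>.\<close>

lemma cb_ORT_le_cb:
  assumes g: "\<And>x y. x \<in> cube n \<Longrightarrow> y \<in> cube n \<Longrightarrow> g (x, y) \<in> {Some 1, None} \<Longrightarrow>
      \<bar>real_of_int (ip n x y) - real k\<bar> \<le> b * sqrt (real (n + k))"
  shows "cb (cube (n + k)) (cube (n + k)) 1 (\<mu> (n + k)) \<epsilon> (ORT b (n + k))
    \<le> cb (cube n) (cube n) 1 (\<mu> n) \<epsilon> g + ereal (2 * real k)"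
proof (cases "cb (cube n) (cube n) 1 (\<mu> n) \<epsilon> g = \<infinity>")
  case False
  obtain S1 S2 where S: "S1 \<subseteq> cube n" "S2 \<subseteq> cube n" "monochromatic (\<mu> n) \<epsilon> 1 g (S1 \<times> S2)"
    "0 < measure_pmf.prob (\<mu> n) (S1 \<times> S2)"
    "cb (cube n) (cube n) 1 (\<mu> n) \<epsilon> g = ereal (- log 2 (measure_pmf.prob (\<mu> n) (S1 \<times> S2)))"
    using cb_attained[OF finite_cube finite_cube False] .
  define e where "e = (\<lambda>(x, y). (pad k 1 x, pad k (-1) y))"
  define h where "h = ORT b (n + k)"
  have e_in: "e ` T \<subseteq> cube (n + k) \<times> cube (n + k)" if "T \<subseteq> cube n \<times> cube n" for T
  proof
    fix p assume "p \<in> e ` T"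
    then obtain x y where "(x, y) \<in> T" "p = (pad k 1 x, pad k (-1) y)" unfolding e_def by auto
    thus "p \<in> cube (n + k) \<times> cube (n + k)" using that by (auto intro!: pad_in_cube)
  qed
  have prob_e: "measure_pmf.prob (\<mu> (n + k)) (e ` T) = measure_pmf.prob (\<mu> n) T / 4 ^ k"
    if "T \<subseteq> cube n \<times> cube n" for T
    using that e_in[OF that] card_pad_rectangle[of k 1 "-1" T]
    unfolding prob_\<mu> by (simp add: Int_absorb2 e_def[symmetric] power_add)
  have img: "pad k 1 ` S1 \<times> pad k (-1) ` S2 = e ` (S1 \<times> S2)"
    unfolding e_def by auto
  have sub: "S1 \<times> S2 \<subseteq> cube n \<times> cube n" using S by auto
  \<comment> \<open>A padded point where ORT is not 1 comes from a point where \<open>g\<close> is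
    neither 1 nor undefined, by the contrapositive of the assumption on \<open>g\<close>.\<close>
  have "e ` (S1 \<times> S2) - (h -` {Some 1} \<union> h -` {None})
      \<subseteq> e ` (S1 \<times> S2 - (g -` {Some 1} \<union> g -` {None}))"
  proof
    fix p assume p: "p \<in> e ` (S1 \<times> S2) - (h -` {Some 1} \<union> h -` {None})"
    then obtain x y where xy: "x \<in> S1" "y \<in> S2" "p = (pad k 1 x, pad k (-1) y)" unfolding e_def by auto
    hence c: "x \<in> cube n" "y \<in> cube n" using S by auto
    have "h p \<noteq> Some 1" using p by auto
    hence "\<not> \<bar>real_of_int (ip n x y) - real k\<bar> \<le> b * sqrt (real (n + k))"
      using xy c ip_pad[of x n y k] unfolding h_def ORT_def by auto
    hence "g (x, y) \<notin> {Some 1, None}" using g c by blast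
    thus "p \<in> e ` (S1 \<times> S2 - (g -` {Some 1} \<union> g -` {None}))"
      using xy unfolding e_def by (intro image_eqI[of _ _ "(x, y)"]) auto
  qed
  hence "measure_pmf.prob (\<mu> (n + k)) (e ` (S1 \<times> S2) - (h -` {Some 1} \<union> h -` {None}))
     \<le> measure_pmf.prob (\<mu> (n + k)) (e ` (S1 \<times> S2 - (g -` {Some 1} \<union> g -` {None})))"
    by (intro measure_pmf.finite_measure_mono) auto
  also have "\<dots> = measure_pmf.prob (\<mu> n) (S1 \<times> S2 - (g -` {Some 1} \<union> g -` {None})) / 4 ^ k"
    using sub by (intro prob_e) auto
  also have "\<dots> \<le> \<epsilon> * measure_pmf.prob (\<mu> n) (S1 \<times> S2) / 4 ^ k"
    using S(3) unfolding monochromatic_def by (intro divide_right_mono) auto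
  also have "\<dots> = \<epsilon> * measure_pmf.prob (\<mu> (n + k)) (e ` (S1 \<times> S2))"
    by (simp add: prob_e[OF sub])
  finally have mono: "monochromatic (\<mu> (n + k)) \<epsilon> 1 h (pad k 1 ` S1 \<times> pad k (-1) ` S2)"
    unfolding monochromatic_def img .
  have "cb (cube (n + k)) (cube (n + k)) 1 (\<mu> (n + k)) \<epsilon> h
     \<le> ereal (- log 2 (measure_pmf.prob (\<mu> n) (S1 \<times> S2) / 4 ^ k))"
  proof (rule cb_le[OF finite_cube finite_cube])
    show "pad k 1 ` S1 \<subseteq> cube (n + k)" "pad k (-1) ` S2 \<subseteq> cube (n + k)"
      using S by (auto intro!: pad_in_cube)
  qed (use S(4) mono in \<open>simp_all add: img prob_e[OF sub]\<close>)
  also have "- log 2 (measure_pmf.prob (\<mu> n) (S1 \<times> S2) / 4 ^ k)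
      = - log 2 (measure_pmf.prob (\<mu> n) (S1 \<times> S2)) + 2 * real k"
  proof -
    have "log 2 (4 ^ k) = 2 * real k"
      using log_nat_power[of 4 2 k] log_pow_cancel[of 2 2] by simp
    thus ?thesis using S(4) by (simp add: log_divide)
  qed
  finally show ?thesis unfolding S(5) h_def by simp
qed simp

text \<open>\<open>restrict\<close> places the function in the extensional function space over which
  \<open>scb\<close> maximises; the points outside the cubes have measure 0 under
  \<open>\<mu> n\<close>.\<close>

definition truncated_GHD :: "real \<Rightarrow> nat \<Rightarrow> int list \<times> int list \<Rightarrow> int option" where
  "truncated_GHD a n = restrict (\<lambda>(x, y).
     if real_of_int (ip n x y) \<ge> a then Some (-1) else GHD n (x, y)) (cube n \<times> cube n)"

lemma truncated_GHD_in_PiE: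
  "truncated_GHD a n \<in> cube n \<times> cube n \<rightarrow>\<^sub>E insert None (Some ` {-1, 1})"
  unfolding truncated_GHD_def by (auto simp: GHD_def split: if_splits)

lemma prob_\<mu>_ip_ge:
  "measure_pmf.prob (\<mu> n) {(x, y). real_of_int (ip n x y) \<ge> a}
     = (\<Sum>j | j \<le> n \<and> a \<le> 2 * real j - real n. binom_prob n j)"
  using prob_\<mu>_ip[of n "\<lambda>i. real_of_int i \<ge> a"] by simp

lemma prob_GHD_neq_truncated_GHD:
  "measure_pmf.prob (\<mu> n) {p. GHD n p \<noteq> truncated_GHD a n p}
    \<le> measure_pmf.prob (\<mu> n) {(x, y). real_of_int (ip n x y) \<ge> a}"
proof -
  have "{p. GHD n p \<noteq> truncated_GHD a n p} \<inter> (cube n \<times> cube n) \<subseteq> {(x, y). real_of_int (ip n x y) \<ge> a}"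
    by (auto simp: truncated_GHD_def split: if_splits)
  thus ?thesis unfolding prob_\<mu>
    by (intro divide_right_mono of_nat_mono card_mono) auto
qed

text \<open>The interval from \<open>- sqrt n\<close> to \<open>1.99 * b * sqrt n + 5\<close> has
  its centre near \<open>k\<close>. Its half-width is \<open>0.995 * b * sqrt n + sqrt n / 2\<close>
  up to a constant, and \<open>b \<ge> 100\<close> is exactly what bounds \<open>sqrt n / 2\<close>
  by \<open>0.005 * b * sqrt n\<close>. The constants (5, and 1 for rounding) are covered by the
  growth from \<open>sqrt n\<close> to \<open>sqrt n'\<close>.\<close>

lemma padding_bounds:
  fixes b :: real
  assumes "b \<ge> 100" "n \<ge> 1"
    "\<bar>real n' - (real n + 1 / 2 * (1.99 * b - 1) * sqrt (real n))\<bar> < 1"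
  obtains k where "n' = n + k" "sqrt (real n) + real k \<le> b * sqrt (real n')"
    "1.99 * b * sqrt (real n) + 5 - real k \<le> b * sqrt (real n')" "real k \<le> b * sqrt (real n)"
proof -
  define s where "s = sqrt (real n)"
  have s1: "s \<ge> 1" and s2: "s\<^sup>2 = real n" using assms by (auto simp: s_def)
  have bs: "100 * s \<le> b * s" using assms s1 by (intro mult_right_mono) auto
  have N: "real n' < real n + 199 / 200 * (b * s) - s / 2 + 1" "real n' > real n + 199 / 200 * (b * s) - s / 2 - 1"
    using assms(3) unfolding s_def[symmetric] by (auto simp: abs_less_iff algebra_simps)
  hence "real n' > real n" using bs s1 by linarith
  hence k: "n' = n + (n' - n)" by simp
  define k where "k = n' - n"
  have rk: "real k = real n' - real n" unfolding k_def using k by linarith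
  \<comment> \<open>From \<open>0.995 * b * s \<ge> 99.5 * s\<close>, minus \<open>s / 2\<close> and
    a rounding error of at most \<open>s\<close>.\<close>
  have k98: "98 * s \<le> real k" using rk N bs s1 by linarith
  \<comment> \<open>Squaring leaves \<open>12 * b * s + 36\<close> to be covered by
    \<open>b\<^sup>2 * k\<close>, which is at least \<open>98 * b * s\<close>.\<close>
  have "b * s + 6 \<le> b * sqrt (real n')"
  proof -
    have "b * s \<ge> 100" using bs s1 by linarith
    have "(b * s + 6)\<^sup>2 = b\<^sup>2 * real n + 12 * (b * s) + 36"
      by (simp add: power2_eq_square algebra_simps flip: s2)
    moreover have "12 * (b * s) + 36 \<le> 98 * (b * s)" using \<open>b * s \<ge> 100\<close> by linarith
    moreover have "98 * (b * s) \<le> b * real k" using mult_left_mono[OF k98, of b] assms by simp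
    moreover have "b * real k \<le> b\<^sup>2 * real k"
      using assms by (intro mult_right_mono) (auto simp: power2_eq_square)
    ultimately have "(b * s + 6)\<^sup>2 \<le> b\<^sup>2 * real n'" using rk by (simp add: algebra_simps)
    hence "b * s + 6 \<le> sqrt (b\<^sup>2 * real n')" by (rule real_le_rsqrt)
    also have "\<dots> = b * sqrt (real n')" using assms by (simp add: real_sqrt_mult)
    finally show ?thesis .
  qed
  moreover have "s + real k \<le> b * s + 6" "199 / 100 * (b * s) + 5 - real k \<le> b * s + 6" "real k \<le> b * s"
    using rk N bs s1 by linarith+
  ultimately show ?thesis
    using that[of k] k unfolding k_def[symmetric] s_def[symmetric] by simp
qed

lemma cb_ORT_le_cb_truncated_GHD:
  fixes b :: real
  assumes "b \<ge> 100" "n \<ge> 1"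
    "\<bar>real n' - (real n + 1 / 2 * (1.99 * b - 1) * sqrt (real n))\<bar> < 1"
  shows "cb (cube n') (cube n') 1 (\<mu> n') \<epsilon> (ORT b n')
    \<le> cb (cube n) (cube n) 1 (\<mu> n) \<epsilon> (truncated_GHD (1.99 * b * sqrt (real n) + 5) n)
        + ereal (2 * b * sqrt (real n))"
proof -
  obtain k where k: "n' = n + k" "sqrt (real n) + real k \<le> b * sqrt (real n')"
    "1.99 * b * sqrt (real n) + 5 - real k \<le> b * sqrt (real n')" "real k \<le> b * sqrt (real n)"
    using padding_bounds[OF assms] .
  define a where "a = 1.99 * b * sqrt (real n) + 5"
  have "cb (cube n') (cube n') 1 (\<mu> n') \<epsilon> (ORT b n')
    \<le> cb (cube n) (cube n) 1 (\<mu> n) \<epsilon> (truncated_GHD a n) + ereal (2 * real k)"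
    unfolding k(1)
  proof (rule cb_ORT_le_cb)
    fix x y assume "x \<in> cube n" "y \<in> cube n" "truncated_GHD a n (x, y) \<in> {Some 1, None}"
    hence "real_of_int (ip n x y) < a" "real_of_int (ip n x y) > - sqrt (real n)"
      by (auto simp: truncated_GHD_def GHD_def split: if_splits)
    thus "\<bar>real_of_int (ip n x y) - real k\<bar> \<le> b * sqrt (real (n + k))"
      using k unfolding a_def k(1) by (simp add: abs_le_iff)
  qed
  also have "\<dots> \<le> cb (cube n) (cube n) 1 (\<mu> n) \<epsilon> (truncated_GHD a n) + ereal (2 * b * sqrt (real n))"
    using k by (intro add_left_mono) simp
  finally show ?thesis unfolding a_def .
qed

section \<open>Rectangles from product distributions\<close>

text \<open>A linear form on the box \<open>[0, M]\<close> to the power \<open>X\<close> is maximal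
  at a vertex: take \<open>M\<close> where the coefficient \<open>w\<close> is positive and 0
  elsewhere.\<close>

lemma weighted_sum_le_subset:
  fixes u w :: "'a \<Rightarrow> real"
  assumes "finite X" "\<And>x. x \<in> X \<Longrightarrow> 0 \<le> u x" "\<And>x. x \<in> X \<Longrightarrow> u x \<le> M" "0 \<le> M"
  shows "\<exists>S\<subseteq>X. (\<Sum>x\<in>X. u x * w x) \<le> M * (\<Sum>x\<in>S. w x)"
proof (intro exI conjI)
  have "(\<Sum>x\<in>X. u x * w x) \<le> (\<Sum>x\<in>X. if 0 < w x then M * w x else 0)"
    using assms by (intro sum_mono) (auto intro: mult_right_mono mult_nonneg_nonpos)
  also have "\<dots> = M * (\<Sum>x\<in>{x\<in>X. 0 < w x}. w x)"
    unfolding sum_distrib_left using assms by (subst sum.inter_filter) auto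
  finally show "(\<Sum>x\<in>X. u x * w x) \<le> M * (\<Sum>x\<in>{x\<in>X. 0 < w x}. w x)" .
qed auto

text \<open>\<open>weighted_sum_le_subset\<close> is applied in \<open>u\<close> with
  \<open>v\<close> fixed, then in \<open>v\<close> with the set \<open>S\<close> fixed. A pair of
  vertices is \<open>M\<^sup>2\<close> times the indicator of a rectangle.\<close>

lemma bilinear_sum_le_rectangle:
  fixes u :: "'a \<Rightarrow> real" and v :: "'b \<Rightarrow> real"
  assumes "finite X" "\<And>x. x \<in> X \<Longrightarrow> 0 \<le> u x" "\<And>x. x \<in> X \<Longrightarrow> u x \<le> M"
    and "finite Y" "\<And>y. y \<in> Y \<Longrightarrow> 0 \<le> v y" "\<And>y. y \<in> Y \<Longrightarrow> v y \<le> M" and "0 \<le> M"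
  obtains S T where "S \<subseteq> X" "T \<subseteq> Y"
    "(\<Sum>x\<in>X. \<Sum>y\<in>Y. u x * v y * h x y) \<le> M\<^sup>2 * (\<Sum>x\<in>S. \<Sum>y\<in>T. h x y)"
proof -
  obtain S where S: "S \<subseteq> X" "(\<Sum>x\<in>X. u x * (\<Sum>y\<in>Y. v y * h x y)) \<le> M * (\<Sum>x\<in>S. \<Sum>y\<in>Y. v y * h x y)"
    using weighted_sum_le_subset[where u = u, OF assms(1-3,7), where w = "\<lambda>x. \<Sum>y\<in>Y. v y * h x y"] by auto
  obtain T where T: "T \<subseteq> Y" "(\<Sum>y\<in>Y. v y * (\<Sum>x\<in>S. h x y)) \<le> M * (\<Sum>y\<in>T. \<Sum>x\<in>S. h x y)"
    using weighted_sum_le_subset[where u = v, OF assms(4-7), where w = "\<lambda>y. \<Sum>x\<in>S. h x y"] by auto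
  have "(\<Sum>x\<in>X. \<Sum>y\<in>Y. u x * v y * h x y) = (\<Sum>x\<in>X. u x * (\<Sum>y\<in>Y. v y * h x y))"
    by (simp add: sum_distrib_left mult.assoc)
  also note S(2)
  also have "(\<Sum>x\<in>S. \<Sum>y\<in>Y. v y * h x y) = (\<Sum>y\<in>Y. v y * (\<Sum>x\<in>S. h x y))"
    by (subst sum.swap) (simp add: sum_distrib_left)
  also have "M * \<dots> \<le> M * (M * (\<Sum>y\<in>T. \<Sum>x\<in>S. h x y))"
    using T(2) assms(7) by (rule mult_left_mono)
  also have "\<dots> = M\<^sup>2 * (\<Sum>x\<in>S. \<Sum>y\<in>T. h x y)"
    by (subst sum.swap) (simp add: power2_eq_square)
  finally show ?thesis using that S(1) T(1) by blast
qed

text \<open>Since \<open>v\<close> rarely takes values below \<open>1/8\<close> in its own weighting, a small probability of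
  \<open>u x * v y > L\<close> forces \<open>u \<le> 8 * L\<close> with high probability.\<close>

lemma sum_truncated_ge:
  fixes u :: "'a \<Rightarrow> real" and v :: "'b \<Rightarrow> real"
  assumes fin: "finite X" "finite Y" and nn: "\<And>x. x \<in> X \<Longrightarrow> 0 \<le> u x" "\<And>y. y \<in> Y \<Longrightarrow> 0 \<le> v y"
    and su: "(\<Sum>x\<in>X. u x) = N" and sv: "(\<Sum>y\<in>Y. v y) = N" and N: "N > 0" "real (card Y) = N"
    and L: "(\<Sum>x\<in>X. \<Sum>y\<in>Y. u x * v y * of_bool (u x * v y > L)) \<le> N\<^sup>2 / 8" and "L > 0"
  shows "6 / 7 * N \<le> (\<Sum>x\<in>{x\<in>X. u x \<le> 8 * L}. u x)"
proof -
  define A where "A = {x\<in>X. u x > 8 * L}"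
  define B where "B = {y\<in>Y. v y > 1 / 8}"
  have "sum v (Y - B) \<le> real (card (Y - B)) * (1 / 8)"
    by (rule sum_bounded_above) (auto simp: B_def)
  also have "\<dots> \<le> N * (1 / 8)"
    using card_mono[of Y "Y - B"] fin N(2) by (intro mult_right_mono) auto
  finally have "sum v B \<ge> 7 / 8 * N"
    using sv sum.subset_diff[of B Y v] fin by (auto simp: B_def)
  moreover have A0: "0 \<le> sum u A" using nn by (auto intro!: sum_nonneg simp: A_def)
  \<comment> \<open>The mass of \<open>A\<close> times \<open>7/8 * N\<close> is at most
    \<open>N\<^sup>2 / 8\<close>, so \<open>A\<close> carries at most \<open>N / 7\<close>.\<close>
  ultimately have "sum u A * (7 / 8 * N) \<le> sum u A * sum v B" by (intro mult_left_mono)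
  also have "\<dots> = (\<Sum>x\<in>A. \<Sum>y\<in>B. u x * v y * of_bool (u x * v y > L))"
    unfolding sum_product
  proof (intro sum.cong refl)
    fix x y assume "x \<in> A" "y \<in> B"
    hence "8 * L * (1 / 8) < u x * v y" using \<open>L > 0\<close> unfolding A_def B_def
      by (intro mult_strict_mono) auto
    thus "u x * v y = u x * v y * of_bool (u x * v y > L)" by simp
  qed
  also have "\<dots> \<le> (\<Sum>x\<in>A. \<Sum>y\<in>Y. u x * v y * of_bool (u x * v y > L))"
    using fin nn by (intro sum_mono sum_mono2) (auto simp: A_def B_def)
  also have "\<dots> \<le> (\<Sum>x\<in>X. \<Sum>y\<in>Y. u x * v y * of_bool (u x * v y > L))"
    using fin nn by (intro sum_mono2 sum_nonneg) (auto simp: A_def)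
  also note L
  finally have "sum u A * (7 / 8 * N) \<le> (N / 7) * (7 / 8 * N)" by (simp add: power2_eq_square)
  hence "sum u A \<le> N / 7" using N by (subst (asm) mult_le_cancel_right) auto
  moreover have "sum u X = sum u A + sum u {x\<in>X. u x \<le> 8 * L}"
    using fin by (subst sum.union_disjoint[symmetric]) (auto simp: A_def intro: sum.cong)
  ultimately show ?thesis using su by simp
qed

text \<open>\<open>u\<close> and \<open>v\<close> are densities of mean 1 relative to the uniform
  distribution. Cutting both at \<open>8 * L\<close> keeps 36/49 of the product mass, so the
  bilinear form with kernel \<open>2 * \<delta> - of_bool (e x y)\<close> stays positive. At a
  maximising vertex, positivity bounds the error by \<open>2 * \<delta>\<close>, and the size of the
  form bounds the rectangle from below.\<close>

lemma rectangle_of_product_density: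
  fixes u :: "'a \<Rightarrow> real" and v :: "'b \<Rightarrow> real"
  assumes fin: "finite X" "finite Y" and nn: "\<And>x. x \<in> X \<Longrightarrow> 0 \<le> u x" "\<And>y. y \<in> Y \<Longrightarrow> 0 \<le> v y"
    and su: "(\<Sum>x\<in>X. u x) = N" and sv: "(\<Sum>y\<in>Y. v y) = N"
    and N: "N > 0" "real (card X) = N" "real (card Y) = N"
    and L: "(\<Sum>x\<in>X. \<Sum>y\<in>Y. u x * v y * of_bool (u x * v y > L)) \<le> N\<^sup>2 / 8" and "L > 0"
    and err: "(\<Sum>x\<in>X. \<Sum>y\<in>Y. u x * v y * of_bool (e x y)) \<le> \<delta> * N\<^sup>2" and "\<delta> > 0"
  obtains S T where "S \<subseteq> X" "T \<subseteq> Y" "(\<Sum>x\<in>S. \<Sum>y\<in>T. of_bool (e x y)) \<le> 2 * \<delta> * (real (card S) * real (card T))"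
    "N\<^sup>2 / (512 * L\<^sup>2) \<le> real (card S) * real (card T)"
proof -
  define X0 where "X0 = {x\<in>X. u x \<le> 8 * L}"
  define Y0 where "Y0 = {y\<in>Y. v y \<le> 8 * L}"
  have X0: "6 / 7 * N \<le> sum u X0"
    unfolding X0_def by (rule sum_truncated_ge[OF fin nn su sv N(1,3) L \<open>L > 0\<close>]) auto
  have L': "(\<Sum>y\<in>Y. \<Sum>x\<in>X. v y * u x * of_bool (v y * u x > L)) \<le> N\<^sup>2 / 8"
    using L by (subst sum.swap) (simp add: mult.commute[of "v _"])
  have Y0: "6 / 7 * N \<le> sum v Y0"
    unfolding Y0_def by (rule sum_truncated_ge[OF fin(2,1) nn(2,1) sv su N(1,2) L' \<open>L > 0\<close>]) auto
  obtain S T where ST: "S \<subseteq> X0" "T \<subseteq> Y0"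
    "(\<Sum>x\<in>X0. \<Sum>y\<in>Y0. u x * v y * (2 * \<delta> - of_bool (e x y))) \<le> (8 * L)\<^sup>2 * (\<Sum>x\<in>S. \<Sum>y\<in>T. 2 * \<delta> - of_bool (e x y))"
    by (rule bilinear_sum_le_rectangle[of X0 u "8 * L" Y0 v "\<lambda>x y. 2 * \<delta> - of_bool (e x y)"])
      (use fin nn \<open>L > 0\<close> in \<open>auto simp: X0_def Y0_def\<close>)
  define k where "k = real (card S) * real (card T)"
  have "(\<Sum>x\<in>X0. \<Sum>y\<in>Y0. u x * v y * of_bool (e x y)) \<le> (\<Sum>x\<in>X. \<Sum>y\<in>Y. u x * v y * of_bool (e x y))"
  proof -
    have "(\<Sum>x\<in>X0. \<Sum>y\<in>Y0. u x * v y * of_bool (e x y)) \<le> (\<Sum>x\<in>X0. \<Sum>y\<in>Y. u x * v y * of_bool (e x y))"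
      using fin nn by (intro sum_mono sum_mono2) (auto simp: X0_def Y0_def)
    also have "\<dots> \<le> (\<Sum>x\<in>X. \<Sum>y\<in>Y. u x * v y * of_bool (e x y))"
      using fin nn by (intro sum_mono2 sum_nonneg) (auto simp: X0_def)
    finally show ?thesis .
  qed
  hence e0: "(\<Sum>x\<in>X0. \<Sum>y\<in>Y0. u x * v y * of_bool (e x y)) \<le> \<delta> * N\<^sup>2" using err by linarith
  have "(6 / 7 * N) * (6 / 7 * N) \<le> sum u X0 * sum v Y0"
    using X0 Y0 N by (intro mult_mono) auto
  hence "2 * \<delta> * (36 / 49 * N\<^sup>2) \<le> 2 * \<delta> * (sum u X0 * sum v Y0)"
    using \<open>\<delta> > 0\<close> by (intro mult_left_mono) (auto simp: power2_eq_square)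
  also have "\<dots> = (\<Sum>x\<in>X0. \<Sum>y\<in>Y0. u x * v y * (2 * \<delta>))"
    unfolding sum_product by (subst sum_distrib_left, intro sum.cong refl, subst sum_distrib_left)
      (intro sum.cong refl, simp)
  \<comment> \<open>Here \<open>23/49 = 2 * 36/49 - 1\<close>; rounding it down to 1/4 later gives
    \<open>512 = 4 * 2 * 8\<^sup>2\<close>.\<close>
  finally have "\<delta> * N\<^sup>2 * (23 / 49) \<le> (\<Sum>x\<in>X0. \<Sum>y\<in>Y0. u x * v y * (2 * \<delta> - of_bool (e x y)))"
    using e0 by (simp add: right_diff_distrib sum_subtractf)
  also note ST(3)
  also have k: "(\<Sum>x\<in>S. \<Sum>y\<in>T. 2 * \<delta> - of_bool (e x y)) = 2 * \<delta> * k - (\<Sum>x\<in>S. \<Sum>y\<in>T. of_bool (e x y))"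
    by (simp add: sum_subtractf k_def)
  finally have main: "\<delta> * N\<^sup>2 * (23 / 49) \<le> (8 * L)\<^sup>2 * (2 * \<delta> * k - (\<Sum>x\<in>S. \<Sum>y\<in>T. of_bool (e x y)))" .
  have pos: "0 < \<delta> * N\<^sup>2 * (23 / 49)" using N \<open>\<delta> > 0\<close> by simp
  hence "0 < (8 * L)\<^sup>2 * (2 * \<delta> * k - (\<Sum>x\<in>S. \<Sum>y\<in>T. of_bool (e x y)))" using main by linarith
  hence 1: "(\<Sum>x\<in>S. \<Sum>y\<in>T. of_bool (e x y)) \<le> 2 * \<delta> * k"
    using \<open>L > 0\<close> by (simp add: zero_less_mult_iff)
  have "\<delta> * N\<^sup>2 * (1 / 4) \<le> \<delta> * N\<^sup>2 * (23 / 49)" using \<open>\<delta> > 0\<close> by (intro mult_left_mono) auto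
  also note main
  also have "(8 * L)\<^sup>2 * (2 * \<delta> * k - (\<Sum>x\<in>S. \<Sum>y\<in>T. of_bool (e x y))) \<le> (8 * L)\<^sup>2 * (2 * \<delta> * k)"
    by (intro mult_left_mono) (auto intro!: sum_nonneg)
  finally have "\<delta> * (N\<^sup>2 * (1 / 4)) \<le> \<delta> * (128 * L\<^sup>2 * k)" by (simp add: power2_eq_square mult_ac)
  hence "N\<^sup>2 * (1 / 4) \<le> 128 * L\<^sup>2 * k" using \<open>\<delta> > 0\<close> by simp
  hence 2: "N\<^sup>2 / (512 * L\<^sup>2) \<le> k" using \<open>L > 0\<close> by (simp add: field_simps)
  show ?thesis using that[of S T] ST(1,2) 1 2 unfolding k_def X0_def Y0_def by blast
qed

section \<open>Transcripts of private-coin protocols\<close>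

lemma pmf_bind_bool:
  "pmf (bind_pmf p f) t = pmf p True * pmf (f True) t + pmf p False * pmf (f False) t"
  unfolding pmf_bind by (subst integral_measure_pmf[of UNIV]) (auto simp: UNIV_bool)

lemma pmf_map_Cons: "pmf (map_pmf ((#) a) p) t = (case t of [] \<Rightarrow> 0 | c # t' \<Rightarrow> if c = a then pmf p t' else 0)"
proof (cases t)
  case (Cons c t')
  show ?thesis
  proof (cases "c = a")
    case True
    thus ?thesis using Cons pmf_map_inj'[of "(#) a" p t'] by simp
  next
    case False
    hence "t \<notin> set_pmf (map_pmf ((#) a) p)" using Cons by auto
    hence "pmf (map_pmf ((#) a) p) t = 0" by (simp only: set_pmf_iff not_not)
    thus ?thesis using Cons False by simp
  qed
next
  case Nil
  hence "t \<notin> set_pmf (map_pmf ((#) a) p)" by auto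
  hence "pmf (map_pmf ((#) a) p) t = 0" by (simp only: set_pmf_iff not_not)
  thus ?thesis using Nil by simp
qed

text \<open>The rectangle property for randomised protocols: each bit depends on the input of one
  party only, so its probability goes into \<open>A\<close> at a node of Alice and into
  \<open>B\<close> at a node of Bob. An inner node sends at least one bit, hence the value 0 at the
  empty transcript.\<close>

lemma transcript_factorises:
  "\<exists>A B. (\<forall>t x. 0 \<le> A t x) \<and> (\<forall>t y. 0 \<le> B t y) \<and> (\<forall>x y t. pmf (transcript P x y) t = A t x * (B t y :: real))"
proof (induction P)
  case (Leaf z)
  show ?case
    by (rule exI[of _ "\<lambda>t x. of_bool (t = [])"], rule exI[of _ "\<lambda>t y. 1"]) (auto simp: pmf_return)
next
  case (Alice q l r)
  then obtain A B A' B' where l: "\<And>t x. 0 \<le> A t x" "\<And>t y. 0 \<le> B t y" "\<And>x y t. pmf (transcript l x y) t = A t x * (B t y :: real)"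
    and r: "\<And>t x. 0 \<le> A' t x" "\<And>t y. 0 \<le> B' t y" "\<And>x y t. pmf (transcript r x y) t = A' t x * (B' t y :: real)"
    by metis
  show ?case
    by (rule exI[of _ "\<lambda>t x. case t of [] \<Rightarrow> 0 | c # t' \<Rightarrow> pmf (q x) c * (if c then A t' x else A' t' x)"],
        rule exI[of _ "\<lambda>t y. case t of [] \<Rightarrow> 0 | c # t' \<Rightarrow> (if c then B t' y else B' t' y)"])
      (use l r in \<open>auto simp: pmf_bind_bool pmf_map_Cons split: list.splits\<close>)
next
  case (Bob q l r)
  then obtain A B A' B' where l: "\<And>t x. 0 \<le> A t x" "\<And>t y. 0 \<le> B t y" "\<And>x y t. pmf (transcript l x y) t = A t x * (B t y :: real)"
    and r: "\<And>t x. 0 \<le> A' t x" "\<And>t y. 0 \<le> B' t y" "\<And>x y t. pmf (transcript r x y) t = A' t x * (B' t y :: real)"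
    by metis
  show ?case
    by (rule exI[of _ "\<lambda>t x. case t of [] \<Rightarrow> 0 | c # t' \<Rightarrow> (if c then A t' x else A' t' x)"],
        rule exI[of _ "\<lambda>t y. case t of [] \<Rightarrow> 0 | c # t' \<Rightarrow> pmf (q y) c * (if c then B t' y else B' t' y)"])
      (use l r in \<open>auto simp: pmf_bind_bool pmf_map_Cons split: list.splits\<close>)
qed

text \<open>The tree is finite, and one set serves all inputs. Averages over transcripts thus become
  finite sums.\<close>

lemma finite_transcripts: "\<exists>F. finite F \<and> (\<forall>x y. set_pmf (transcript P x y) \<subseteq> F)"
proof (induction P)
  case (Leaf z)
  show ?case by (rule exI[of _ "{[]}"]) auto
next
  case (Alice q l r)
  then obtain F G where "finite F" "finite G" "\<And>x y. set_pmf (transcript l x y) \<subseteq> F" "\<And>x y. set_pmf (transcript r x y) \<subseteq> G"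
    by metis
  thus ?case
    by (intro exI[of _ "(#) True ` F \<union> (#) False ` G"]) (fastforce split: if_splits)
next
  case (Bob q l r)
  then obtain F G where "finite F" "finite G" "\<And>x y. set_pmf (transcript l x y) \<subseteq> F" "\<And>x y. set_pmf (transcript r x y) \<subseteq> G"
    by metis
  thus ?case
    by (intro exI[of _ "(#) True ` F \<union> (#) False ` G"]) (fastforce split: if_splits)
qed

section \<open>Information cost\<close>

text \<open>From \<open>ln f \<ge> 1 - 1 / f\<close> follows
  \<open>f * ln f \<ge> f - 1 \<ge> -1\<close>; dividing by \<open>ln 2 \<ge> 1/2\<close> gives
  -2.\<close>

lemma mult_log2_ge:
  assumes "0 \<le> (f::real)"
  shows "- 2 \<le> f * log 2 f"
proof (cases "f = 0")
  case False
  hence f: "f > 0" using assms by simp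
  have l: "1 / 2 \<le> ln (2::real)" using ln2_ge_two_thirds by simp
  have "ln (1 / f) \<le> 1 / f - 1" using f by (intro ln_le_minus_one) simp
  hence "ln f \<ge> 1 - 1 / f" using f by (simp add: ln_div)
  from mult_left_mono[OF this assms] have "f * ln f \<ge> f - 1" using f by (simp add: algebra_simps)
  hence "- 2 * ln 2 \<le> f * ln f" using f l by linarith
  thus ?thesis using l by (simp add: log_def field_simps)
qed simp

lemma measure_pmf_eq_density_pmf:
  assumes "set_pmf N \<subseteq> set_pmf M"
  shows "measure_pmf N = density (measure_pmf M) (\<lambda>x. ennreal (pmf N x / pmf M x))"
proof -
  have "density (measure_pmf M) (\<lambda>x. ennreal (pmf N x / pmf M x))
     = density (count_space UNIV) (\<lambda>x. ennreal (pmf M x) * ennreal (pmf N x / pmf M x))"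
    unfolding measure_pmf_eq_density by (subst density_density_eq) auto
  also have "(\<lambda>x. ennreal (pmf M x) * ennreal (pmf N x / pmf M x)) = (\<lambda>x. ennreal (pmf N x))"
  proof
    fix x
    have "pmf M x * (pmf N x / pmf M x) = pmf N x"
      using assms by (cases "x \<in> set_pmf M") (auto simp: set_pmf_iff)
    thus "ennreal (pmf M x) * ennreal (pmf N x / pmf M x) = ennreal (pmf N x)"
      by (simp flip: ennreal_mult')
  qed
  finally show ?thesis by (simp add: measure_pmf_eq_density)
qed

text \<open>A Markov-type estimate for \<open>f * log 2 f\<close>, where \<open>f\<close> is the
  density: it is at least \<open>K * f\<close> where \<open>f > 2 powr K\<close> and at least -2
  elsewhere. The bound \<open>B\<close> on the density makes all integrals exist.\<close>

lemma KL_divergence_pmf_ge: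
  fixes M N :: "'a pmf"
  assumes sub: "set_pmf N \<subseteq> set_pmf M" and B: "\<And>x. pmf N x / pmf M x \<le> B" and "K \<ge> 0"
  shows "K * measure_pmf.prob N {x. pmf N x > 2 powr K * pmf M x} - 2 \<le> KL_divergence 2 (measure_pmf M) (measure_pmf N)"
proof -
  define f where "f = (\<lambda>x. pmf N x / pmf M x)"
  define S where "S = {x. pmf N x > 2 powr K * pmf M x}"
  have dens: "measure_pmf N = density (measure_pmf M) (\<lambda>x. ennreal (f x))"
    unfolding f_def by (rule measure_pmf_eq_density_pmf[OF sub])
  have f0: "0 \<le> f x" and fB: "f x \<le> B" for x using B by (auto simp: f_def)
  have int_f: "integrable (measure_pmf M) (\<lambda>x. f x * indicator S x)"
    using f0 fB by (intro measure_pmf.integrable_const_bound[where B = B])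
      (auto simp: indicator_def intro: order_trans)
  have int_log: "integrable (measure_pmf M) (\<lambda>x. f x * log 2 (f x))"
  proof (rule measure_pmf.integrable_const_bound[where B = "2 + B * B * 2"])
    have "\<bar>f x * log 2 (f x)\<bar> \<le> 2 + B * B * 2" for x
    proof -
      have "f x * log 2 (f x) \<le> 2 + B * B * 2"
      proof (cases "f x = 0")
        case False
        have l: "1 / 2 \<le> ln (2::real)" using ln2_ge_two_thirds by simp
        have fp: "f x > 0" using False f0[of x] by simp
        have "ln (f x) \<le> f x" using ln_le_minus_one[OF fp] by simp
        \<comment> \<open>Since \<open>ln 2 \<ge> 1/2\<close>, this yields
          \<open>log 2 f \<le> 2 * f\<close>, so \<open>f * log 2 f\<close> is at most
          \<open>2 * B\<^sup>2\<close>.\<close>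
        also have "\<dots> \<le> f x * 2 * ln 2" using l fp mult_left_mono[OF l, of "2 * f x"] by simp
        finally have "log 2 (f x) \<le> 2 * f x" using l by (simp add: log_def field_simps)
        hence "f x * log 2 (f x) \<le> f x * (2 * f x)" using f0 by (intro mult_left_mono)
        also have "\<dots> \<le> B * (2 * B)" using f0[of x] fB[of x] by (intro mult_mono) auto
        finally show ?thesis by simp
      qed simp
      moreover have "f x * log 2 (f x) \<ge> - (2 + B * B * 2)"
      proof -
        have "0 \<le> B * B * 2" by simp
        thus ?thesis using mult_log2_ge[OF f0, of x] by linarith
      qed
      ultimately show ?thesis by (simp add: abs_le_iff)
    qed
    thus "AE x in measure_pmf M. norm (f x * log 2 (f x)) \<le> 2 + B * B * 2" by simp
  qed simp
  have "measure_pmf.prob N S = (\<integral>x. indicator S x \<partial>measure_pmf N)" by simp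
  also have "\<dots> = (\<integral>x. f x * indicator S x \<partial>measure_pmf M)"
    unfolding dens by (subst integral_real_density) (auto simp: f0)
  finally have "K * measure_pmf.prob N S - 2 = (\<integral>x. K * (f x * indicator S x) - 2 \<partial>measure_pmf M)"
    using int_f by simp
  also have "\<dots> \<le> (\<integral>x. f x * log 2 (f x) \<partial>measure_pmf M)"
  proof (rule integral_mono_AE)
    show "integrable (measure_pmf M) (\<lambda>x. K * (f x * indicator S x) - 2)" using int_f by simp
    show "AE x in measure_pmf M. K * (f x * indicator S x) - 2 \<le> f x * log 2 (f x)"
    proof (rule AE_pmfI)
      fix x assume "x \<in> set_pmf M"
      hence p: "pmf M x > 0" by (simp add: pmf_positive)
      show "K * (f x * indicator S x) - 2 \<le> f x * log 2 (f x)"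
      proof (cases "x \<in> S")
        case True
        hence "2 powr K < f x" using p by (simp add: S_def f_def field_simps)
        hence "K \<le> log 2 (f x)"
          using log_le_cancel_iff[of 2 "2 powr K" "f x"] order.strict_trans[of 0 "2 powr K" "f x"] by simp
        hence "f x * K \<le> f x * log 2 (f x)" using f0 by (intro mult_left_mono)
        thus ?thesis using True by (simp add: mult.commute)
      next
        case False
        thus ?thesis using mult_log2_ge[OF f0, of x] by simp
      qed
    qed
  qed (rule int_log)
  also have "\<dots> = KL_divergence 2 (measure_pmf M) (measure_pmf N)"
    unfolding dens by (rule sigma_finite_measure.KL_density[OF measure_pmf.sigma_finite_measure_axioms, symmetric]) (auto simp: f0)
  finally show ?thesis unfolding S_def .
qed

section \<open>Mutual information of discrete variables\<close>

lemma pair_measure_pmf: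
  fixes A :: "'a::countable pmf" and B :: "'b::countable pmf"
  shows "measure_pmf A \<Otimes>\<^sub>M measure_pmf B = measure_pmf (pair_pmf A B)"
proof (rule pair_measure_eqI)
  show "sets (measure_pmf A \<Otimes>\<^sub>M measure_pmf B) = sets (measure_pmf (pair_pmf A B))"
  proof -
    have "sets (measure_pmf A \<Otimes>\<^sub>M measure_pmf B)
        = sets (count_space (UNIV :: 'a set) \<Otimes>\<^sub>M count_space (UNIV :: 'b set))"
      by (rule sets_pair_measure_cong) simp_all
    \<comment> \<open>Countability makes the product of the discrete sigma-algebras
      discrete.\<close>
    also have "\<dots> = sets (count_space (UNIV \<times> UNIV))"
      by (subst pair_measure_countable) auto
    finally show ?thesis by simp
  qed
  fix S T assume "S \<in> sets (measure_pmf A)" "T \<in> sets (measure_pmf B)"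
  have "emeasure (measure_pmf (pair_pmf A B)) (S \<times> T) = (\<integral>\<^sup>+x. indicator (S \<times> T) x \<partial>measure_pmf (pair_pmf A B))"
    by simp
  also have "\<dots> = (\<integral>\<^sup>+a. \<integral>\<^sup>+b. indicator S a * indicator T b \<partial>B \<partial>A)"
    unfolding nn_integral_pair_pmf' by (simp add: indicator_times)
  also have "\<dots> = emeasure (measure_pmf A) S * emeasure (measure_pmf B) T"
    by (simp add: nn_integral_cmult nn_integral_multc)
  finally show "emeasure (measure_pmf A) S * emeasure (measure_pmf B) T = emeasure (measure_pmf (pair_pmf A B)) (S \<times> T)"
    by simp
qed (rule measure_pmf.sigma_finite_measure_axioms)+

lemma mutual_information_pmf:
  fixes E :: "'c pmf" and X :: "'c \<Rightarrow> 'a::countable" and Y :: "'c \<Rightarrow> 'b::countable"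
  shows "prob_space.mutual_information (measure_pmf E) 2 (count_space UNIV) (count_space UNIV) X Y
    = KL_divergence 2 (measure_pmf (pair_pmf (map_pmf X E) (map_pmf Y E))) (measure_pmf (map_pmf (\<lambda>e. (X e, Y e)) E))"
  unfolding prob_space.mutual_information_def[OF prob_space_measure_pmf]
  by (simp add: pair_measure_countable pair_measure_pmf flip: map_pmf_rep_eq)

text \<open>The probability of \<open>t\<close> averaged over the inputs; dividing the likelihood of
  \<open>t\<close> by it gives the density of the joint law with respect to the product of the
  marginals.\<close>

definition transcript_prob :: "('x \<times> 'y) pmf \<Rightarrow> ('x, 'y, 'z) ptree \<Rightarrow> bool list \<Rightarrow> real" where
  "transcript_prob \<nu> P t = measure_pmf.expectation \<nu> (\<lambda>(x, y). pmf (transcript P x y) t)"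

lemma pmf_execution:
  "pmf (execution P \<nu>) (r, (x, y), t) = pmf (fst P) r * (pmf \<nu> (x, y) * pmf (transcript (snd P r) x y) t)"
proof -
  have m: "pmf (map_pmf (\<lambda>t. (r', (x', y'), t)) q) (r, (x, y), t)
      = (if r' = r \<and> x' = x \<and> y' = y then pmf q t else 0)" for r' x' y' and q :: "bool list pmf"
  proof (cases "r' = r \<and> x' = x \<and> y' = y")
    case True
    have "inj (\<lambda>t. (r', (x', y'), t))" by (auto simp: inj_def)
    from pmf_map_inj'[OF this, of q t] True show ?thesis by simp
  next
    case False
    hence "(r, (x, y), t) \<notin> set_pmf (map_pmf (\<lambda>t. (r', (x', y'), t)) q)" by auto
    hence "pmf (map_pmf (\<lambda>t. (r', (x', y'), t)) q) (r, (x, y), t) = 0" by (simp only: set_pmf_iff not_not)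
    thus ?thesis using False by auto
  qed
  have "pmf (bind_pmf \<nu> (\<lambda>(x', y'). map_pmf (\<lambda>t. (r', (x', y'), t)) (transcript (snd P r') x' y'))) (r, (x, y), t)
     = (if r' = r then pmf \<nu> (x, y) * pmf (transcript (snd P r) x y) t else 0)" for r'
    unfolding pmf_bind
    by (subst integral_measure_pmf[of "{(x, y)}"]) (auto simp: m split: if_splits)
  thus ?thesis
    unfolding execution_def pmf_bind[of "fst P"]
    by (subst integral_measure_pmf[of "{r}"]) (auto split: if_splits)
qed

text \<open>The inputs are independent of the public coins, so they share no information with
  them.\<close>

lemma map_execution_public: "map_pmf (\<lambda>(r, xy, t). (xy, r)) (execution P \<nu>) = pair_pmf \<nu> (fst P)"
proof -
  have "map_pmf (\<lambda>(r, xy, t). (xy, r)) (execution P \<nu>)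
     = bind_pmf (fst P) (\<lambda>r. bind_pmf \<nu> (\<lambda>xy. return_pmf (xy, r)))"
    by (simp add: execution_def map_bind_pmf case_prod_unfold map_pmf_comp map_pmf_const)
  also have "\<dots> = pair_pmf \<nu> (fst P)"
    unfolding pair_pmf_def by (rule bind_commute_pmf)
  finally show ?thesis .
qed

lemma pmf_execution_public_transcript:
  "pmf (map_pmf (\<lambda>(r, xy, t). (t, r)) (execution P \<nu>)) (t, r) = pmf (fst P) r * transcript_prob \<nu> (snd P r) t"
proof -
  have "map_pmf (\<lambda>(r, xy, t). (t, r)) (execution P \<nu>)
    = bind_pmf (fst P) (\<lambda>r'. map_pmf (\<lambda>t. (t, r')) (bind_pmf \<nu> (\<lambda>(x, y). transcript (snd P r') x y)))"
    by (simp add: execution_def map_bind_pmf case_prod_unfold map_pmf_comp)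
  also have "pmf \<dots> (t, r) = (\<Sum>r'\<in>{r}. pmf (fst P) r' * pmf (bind_pmf \<nu> (\<lambda>(x, y). transcript (snd P r') x y)) t)"
  proof -
    have m: "pmf (map_pmf (\<lambda>t. (t, r')) q) (t, r) = (if r' = r then pmf q t else 0)" for r' and q :: "bool list pmf"
    proof (cases "r' = r")
      case True
      have "inj (\<lambda>t. (t, r'))" by (auto simp: inj_def)
      from pmf_map_inj'[OF this, of q t] True show ?thesis by simp
    next
      case False
      hence "(t, r) \<notin> set_pmf (map_pmf (\<lambda>t. (t, r')) q)" by auto
      hence "pmf (map_pmf (\<lambda>t. (t, r')) q) (t, r) = 0" by (simp only: set_pmf_iff not_not)
      thus ?thesis using False by auto
    qed
    show ?thesis unfolding pmf_bind[of "fst P"]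
      by (subst integral_measure_pmf[of "{r}"]) (auto simp: m split: if_splits)
  qed
  also have "\<dots> = pmf (fst P) r * transcript_prob \<nu> (snd P r) t"
    by (simp add: pmf_bind transcript_prob_def case_prod_unfold)
  finally show ?thesis .
qed

text \<open>Conditional mutual information is the information of the inputs about transcript and
  coins together, minus that about the coins alone. The latter vanishes by
  \<open>map_execution_public\<close>, and the former is a divergence to which
  \<open>KL_divergence_pmf_ge\<close> applies.\<close>

lemma icost_ge:
  fixes \<nu> :: "('x::countable \<times> 'y::countable) pmf"
  assumes fin: "finite (set_pmf \<nu>)" and "K \<ge> 0"
  shows "K * measure_pmf.prob (execution P \<nu>)
      {(r, (x, y), t). pmf (transcript (snd P r) x y) t > 2 powr K * transcript_prob \<nu> (snd P r) t} - 2 \<le> icost \<nu> P"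
proof -
  define E where "E = execution P \<nu>"
  define J where "J = map_pmf (\<lambda>(r, xy, t). (xy, t, r)) E"
  define Q where "Q = map_pmf (\<lambda>(r, xy, t). (t, r)) E"
  define M where "M = pair_pmf \<nu> Q"
  have xr: "map_pmf (\<lambda>(r, xy, t). (xy, r)) E = pair_pmf \<nu> (fst P)"
    unfolding E_def by (rule map_execution_public)
  have x: "map_pmf (\<lambda>(r, xy, t). xy) E = \<nu>"
    using arg_cong[OF xr, of "map_pmf fst"] by (simp add: map_fst_pair_pmf map_pmf_comp case_prod_unfold)
  have r: "map_pmf (\<lambda>(r, xy, t). r) E = fst P"
    using arg_cong[OF xr, of "map_pmf snd"] by (simp add: map_snd_pair_pmf map_pmf_comp case_prod_unfold)
  have "icost \<nu> P = KL_divergence 2 (measure_pmf M) (measure_pmf J)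
      - KL_divergence 2 (measure_pmf (pair_pmf \<nu> (fst P))) (measure_pmf (pair_pmf \<nu> (fst P)))"
    unfolding icost_def prob_space.conditional_mutual_information_def[OF prob_space_measure_pmf] E_def[symmetric]
    using x r xr
    by (simp add: pair_measure_countable mutual_information_pmf M_def J_def Q_def case_prod_unfold)
  also have "KL_divergence 2 (measure_pmf (pair_pmf \<nu> (fst P))) (measure_pmf (pair_pmf \<nu> (fst P))) = 0"
    by (rule sigma_finite_measure.KL_same_eq_0[OF measure_pmf.sigma_finite_measure_axioms])
  finally have icost: "icost \<nu> P = KL_divergence 2 (measure_pmf M) (measure_pmf J)" by simp
  have pJ: "pmf J ((x, y), t, r) = pmf (fst P) r * (pmf \<nu> (x, y) * pmf (transcript (snd P r) x y) t)" for x y t r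
  proof -
    have "inj (\<lambda>(r, xy, t). (xy, t, r))" by (auto simp: inj_def)
    from pmf_map_inj'[OF this, of E "(r, (x, y), t)"] show ?thesis
      by (simp add: J_def E_def pmf_execution)
  qed
  have pM: "pmf M ((x, y), t, r) = pmf \<nu> (x, y) * (pmf (fst P) r * transcript_prob \<nu> (snd P r) t)" for x y t r
    by (simp add: M_def pmf_pair Q_def E_def pmf_execution_public_transcript)
  have JM1: "map_pmf fst J = \<nu>" and JM2: "map_pmf snd J = Q"
    using x by (simp_all add: J_def Q_def map_pmf_comp case_prod_unfold)
  have sub: "set_pmf J \<subseteq> set_pmf M"
    unfolding M_def JM1[symmetric] JM2[symmetric] by (auto intro: rev_image_eqI)
  have JQ: "pmf J (xy, q) \<le> pmf Q q" for xy q
  proof -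
    have "pmf J (xy, q) \<le> measure_pmf.prob J (snd -` {q})"
      by (subst measure_pmf_single[symmetric]) (intro measure_pmf.finite_measure_mono, auto)
    also have "\<dots> = pmf Q q" unfolding JM2[symmetric] by (simp add: pmf_map)
    finally show ?thesis .
  qed
  \<comment> \<open>At inputs \<open>xy\<close> the density is at most
    \<open>1 / pmf \<nu> xy\<close>; the sum over the finite support is a bound uniform in
    \<open>xy\<close>.\<close>
  define B where "B = (\<Sum>xy\<in>set_pmf \<nu>. 1 / pmf \<nu> xy)"
  have B0: "B \<ge> 0" unfolding B_def by (intro sum_nonneg) auto
  have B: "pmf J p / pmf M p \<le> B" for p
  proof -
    obtain xy q where Pair: "p = (xy, q)" by (rule prod.exhaust)
    show ?thesis
    proof (cases "p \<in> set_pmf M")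
      case True
      hence xy: "xy \<in> set_pmf \<nu>" "pmf Q q > 0" "pmf \<nu> xy > 0" unfolding Pair M_def by (auto simp: pmf_positive)
      have "pmf J p / pmf M p \<le> pmf Q q / (pmf \<nu> xy * pmf Q q)"
        unfolding Pair M_def pmf_pair using JQ[of xy q] by (intro divide_right_mono) auto
      also have "\<dots> = 1 / pmf \<nu> xy" using xy by simp
      also have "\<dots> \<le> B" unfolding B_def using xy fin by (intro member_le_sum) auto
      finally show ?thesis .
    qed (use B0 in \<open>auto simp: set_pmf_iff\<close>)
  qed
  define S where "S = {p. pmf J p > 2 powr K * pmf M p}"
  define S' where "S' = {(r, (x, y), t). pmf (transcript (snd P r) x y) t > 2 powr K * transcript_prob \<nu> (snd P r) t}"
  have "measure_pmf.prob E S' \<le> measure_pmf.prob E ((\<lambda>(r, xy, t). (xy, t, r)) -` S)"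
  proof (rule measure_pmf.finite_measure_mono_AE)
    \<comment> \<open>Only almost surely: the common factor of both probabilities must be positive
      to preserve the strict inequality.\<close>
    show "AE e in measure_pmf E. e \<in> S' \<longrightarrow> e \<in> (\<lambda>(r, xy, t). (xy, t, r)) -` S"
    proof (rule AE_pmfI, rule impI)
      fix e assume e: "e \<in> set_pmf E" "e \<in> S'"
      obtain r x y t where [simp]: "e = (r, (x, y), t)" by (metis prod_cases4 surj_pair)
      have "pmf E e > 0" using e(1) by (simp add: pmf_positive)
      hence pos: "0 < pmf (fst P) r * pmf \<nu> (x, y)"
        by (simp add: E_def pmf_execution zero_less_mult_iff not_less[symmetric])
      have "2 powr K * transcript_prob \<nu> (snd P r) t < pmf (transcript (snd P r) x y) t"
        using e(2) by (simp add: S'_def)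
      from mult_strict_left_mono[OF this pos] show "e \<in> (\<lambda>(r, xy, t). (xy, t, r)) -` S"
        by (simp add: S_def pJ pM mult_ac)
    qed
  qed auto
  also have "\<dots> = measure_pmf.prob J S" by (simp add: J_def)
  finally have "K * measure_pmf.prob E S' \<le> K * measure_pmf.prob J S" using \<open>K \<ge> 0\<close> by (rule mult_left_mono)
  moreover have "K * measure_pmf.prob J S - 2 \<le> icost \<nu> P"
    unfolding icost S_def using sub B \<open>K \<ge> 0\<close> by (rule KL_divergence_pmf_ge)
  ultimately show ?thesis unfolding S'_def E_def by linarith
qed

section \<open>Extracting a rectangle from a protocol\<close>

lemma prob_bind_pmf:
  "measure_pmf.prob (bind_pmf M N) S = measure_pmf.expectation M (\<lambda>x. measure_pmf.prob (N x) S)"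
proof -
  have p: "measure_pmf.prob q S = pmf (map_pmf (\<lambda>x. x \<in> S) q) True" for q
    by (simp add: pmf_map vimage_def)
  show ?thesis unfolding p by (simp add: map_bind_pmf pmf_bind)
qed

lemma prob_execution_fixed_public:
  assumes "finite (set_pmf \<nu>)" "finite F" "\<And>x y. set_pmf (transcript Q x y) \<subseteq> F"
  shows "measure_pmf.prob (bind_pmf \<nu> (\<lambda>(x, y). map_pmf (\<lambda>t. (r, (x, y), t)) (transcript Q x y))) S
    = (\<Sum>t\<in>F. \<Sum>(x, y)\<in>set_pmf \<nu>. pmf \<nu> (x, y) * pmf (transcript Q x y) t * of_bool ((r, (x, y), t) \<in> S))"
proof -
  have 1: "measure_pmf.prob (map_pmf (\<lambda>t. (r, (x, y), t)) (transcript Q x y)) S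
    = (\<Sum>t\<in>F. pmf (transcript Q x y) t * of_bool ((r, (x, y), t) \<in> S))" for x y
  proof -
    have "measure_pmf.prob (map_pmf (\<lambda>t. (r, (x, y), t)) (transcript Q x y)) S
      = measure_pmf.expectation (transcript Q x y) (indicator {t. (r, (x, y), t) \<in> S})"
      by (simp add: vimage_def)
    also have "\<dots> = (\<Sum>t\<in>F. pmf (transcript Q x y) t *\<^sub>R indicator {t. (r, (x, y), t) \<in> S} t)"
      using assms by (intro integral_measure_pmf) auto
    finally show ?thesis by (simp add: indicator_def of_bool_def)
  qed
  have "measure_pmf.prob (bind_pmf \<nu> (\<lambda>(x, y). map_pmf (\<lambda>t. (r, (x, y), t)) (transcript Q x y))) S
    = (\<Sum>p\<in>set_pmf \<nu>. pmf \<nu> p * (\<Sum>t\<in>F. pmf (transcript Q (fst p) (snd p)) t * of_bool ((r, p, t) \<in> S)))"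
    unfolding prob_bind_pmf
  proof (subst integral_measure_pmf[OF assms(1)])
    show "(\<Sum>p\<in>set_pmf \<nu>. pmf \<nu> p *\<^sub>R
        measure_pmf.prob (case p of (x, y) \<Rightarrow> map_pmf (\<lambda>t. (r, (x, y), t)) (transcript Q x y)) S)
      = (\<Sum>p\<in>set_pmf \<nu>. pmf \<nu> p * (\<Sum>t\<in>F. pmf (transcript Q (fst p) (snd p)) t * of_bool ((r, p, t) \<in> S)))"
      by (intro sum.cong refl) (auto simp: 1 simp del: measure_map_pmf)
  qed auto
  also have "\<dots> = (\<Sum>t\<in>F. \<Sum>p\<in>set_pmf \<nu>. pmf \<nu> p * pmf (transcript Q (fst p) (snd p)) t * of_bool ((r, p, t) \<in> S))"
    by (simp add: sum_distrib_left mult.assoc) (rule sum.swap)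
  finally show ?thesis by (simp add: case_prod_unfold)
qed

text \<open>Averaging, first over the public coins and then over the transcripts of the chosen
  protocol. \<open>G\<close> does not involve the inputs, so it factors out of the sum over them,
  and a negative term forces \<open>G r t\<close>.\<close>

lemma exists_transcript_below_average:
  assumes fin: "finite (set_pmf \<nu>)"
    and less: "c1 * measure_pmf.prob (execution P \<nu>) {(r, (x, y), t). G r t \<and> e1 r x y t}
      + c2 * measure_pmf.prob (execution P \<nu>) {(r, (x, y), t). G r t \<and> e2 r x y t}
      < measure_pmf.prob (execution P \<nu>) {(r, (x, y), t). G r t}"
  obtains r t where "G r t"
    "c1 * (\<Sum>(x, y)\<in>set_pmf \<nu>. pmf \<nu> (x, y) * pmf (transcript (snd P r) x y) t * of_bool (e1 r x y t))
     + c2 * (\<Sum>(x, y)\<in>set_pmf \<nu>. pmf \<nu> (x, y) * pmf (transcript (snd P r) x y) t * of_bool (e2 r x y t))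
      < (\<Sum>(x, y)\<in>set_pmf \<nu>. pmf \<nu> (x, y) * pmf (transcript (snd P r) x y) t)"
proof -
  define E where "E = (\<lambda>r. bind_pmf \<nu> (\<lambda>(x, y). map_pmf (\<lambda>t. (r, (x, y), t)) (transcript (snd P r) x y)))"
  define S1 where "S1 = {(r, (x, y), t). G r t \<and> e1 r x y t}"
  define S2 where "S2 = {(r, (x, y), t). G r t \<and> e2 r x y t}"
  define S where "S = {(r, (x::'a, y::'b), t). G r t}"
  have prob: "measure_pmf.prob (execution P \<nu>) A = measure_pmf.expectation (fst P) (\<lambda>r. measure_pmf.prob (E r) A)" for A
    unfolding execution_def prob_bind_pmf[of "fst P"] E_def ..
  have int: "integrable (measure_pmf (fst P)) (\<lambda>r. measure_pmf.prob (E r) A)" for A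
    by (rule measure_pmf.integrable_const_bound[where B = 1]) auto
  define D where "D = (\<lambda>r. c1 * measure_pmf.prob (E r) S1 + c2 * measure_pmf.prob (E r) S2 - measure_pmf.prob (E r) S)"
  have "measure_pmf.expectation (fst P) D < 0"
    using less unfolding S1_def[symmetric] S2_def[symmetric] S_def[symmetric] prob D_def
    by (simp add: int)
  then obtain r where "D r < 0"
    using Bochner_Integration.integral_nonneg[of "measure_pmf (fst P)" D] by (metis not_le)
  obtain F where F: "finite F" "\<And>x y. set_pmf (transcript (snd P r) x y) \<subseteq> F"
    using finite_transcripts[of "snd P r"] by auto
  define w where "w = (\<lambda>t x y. pmf \<nu> (x, y) * pmf (transcript (snd P r) x y) t)"
  define H where "H = (\<lambda>t. c1 * (\<Sum>(x, y)\<in>set_pmf \<nu>. w t x y * of_bool (e1 r x y t))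
     + c2 * (\<Sum>(x, y)\<in>set_pmf \<nu>. w t x y * of_bool (e2 r x y t)) - (\<Sum>(x, y)\<in>set_pmf \<nu>. w t x y))"
  have p: "measure_pmf.prob (E r) A = (\<Sum>t\<in>F. \<Sum>(x, y)\<in>set_pmf \<nu>. w t x y * of_bool ((r, (x, y), t) \<in> A))" for A
    unfolding E_def w_def by (rule prob_execution_fixed_public[OF fin F])
  have "D r = (\<Sum>t\<in>F. of_bool (G r t) * H t)"
    unfolding D_def p S1_def S2_def S_def H_def
    by (simp add: sum_distrib_left sum_subtractf sum.distrib case_prod_unfold algebra_simps of_bool_conj)
  with \<open>D r < 0\<close> obtain t where "of_bool (G r t) * H t < 0"
    using sum_nonneg[of F "\<lambda>t. of_bool (G r t) * H t"] by (metis not_le)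
  hence "G r t" "H t < 0" by (auto simp: of_bool_def split: if_splits)
  thus ?thesis using that[of r t] unfolding H_def w_def by simp
qed

text \<open>By \<open>transcript_factorises\<close> the posterior of uniform inputs given
  \<open>t\<close> is a product distribution. The weights \<open>1 / \<delta>\<close> and 8 combine
  two conditions in one inequality: the posterior meets \<open>e\<close> with probability at most
  \<open>\<delta>\<close>, and its density exceeds \<open>L\<close> with probability at most
  1/8.\<close>

lemma rectangle_of_transcript:
  fixes Q :: "(int list, int list, 'z) ptree"
  assumes "L > 0" "\<delta> > 0"
    and less: "1 / \<delta> * (\<Sum>(x, y)\<in>cube n \<times> cube n. pmf (transcript Q x y) t * of_bool (e x y))
      + 8 * (\<Sum>(x, y)\<in>cube n \<times> cube n. pmf (transcript Q x y) t * of_bool (pmf (transcript Q x y) t > L * transcript_prob (\<mu> n) Q t))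
      < (\<Sum>(x, y)\<in>cube n \<times> cube n. pmf (transcript Q x y) t)"
  obtains S T where "S \<subseteq> cube n" "T \<subseteq> cube n"
    "(\<Sum>x\<in>S. \<Sum>y\<in>T. of_bool (e x y)) \<le> 2 * \<delta> * (real (card S) * real (card T))"
    "4 ^ n / (512 * L\<^sup>2) \<le> real (card S) * real (card T)"
proof -
  obtain A B where AB: "\<And>t x. 0 \<le> A t x" "\<And>t y. 0 \<le> B t y" "\<And>x y t. pmf (transcript Q x y) t = A t x * (B t y :: real)"
    using transcript_factorises[of Q] by blast
  define N where "N = (2::real) ^ n"
  define a where "a = (\<Sum>x\<in>cube n. A t x)"
  define b where "b = (\<Sum>y\<in>cube n. B t y)"
  have N: "N > 0" "real (card (cube n)) = N" "N\<^sup>2 = 4 ^ n"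
    by (auto simp: N_def card_cube power2_eq_square simp flip: power_mult_distrib)
  have tot: "(\<Sum>(x, y)\<in>cube n \<times> cube n. pmf (transcript Q x y) t) = a * b"
    unfolding a_def b_def AB(3) by (simp add: sum_product sum.cartesian_product)
  have tp: "transcript_prob (\<mu> n) Q t = a * b / N\<^sup>2"
  proof -
    have "transcript_prob (\<mu> n) Q t = (\<Sum>p\<in>cube n \<times> cube n. pmf (\<mu> n) p *\<^sub>R (case p of (x, y) \<Rightarrow> pmf (transcript Q x y) t))"
      unfolding transcript_prob_def by (rule integral_measure_pmf) (auto simp: set_pmf_\<mu>)
    also have "\<dots> = (\<Sum>p\<in>cube n \<times> cube n. (case p of (x, y) \<Rightarrow> pmf (transcript Q x y) t) / N\<^sup>2)"
      by (intro sum.cong) (auto simp: pmf_\<mu> N)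
    finally show ?thesis by (simp add: tot flip: sum_divide_distrib)
  qed
  define e1 where "e1 = (\<Sum>(x, y)\<in>cube n \<times> cube n. A t x * B t y * of_bool (e x y))"
  define e2 where "e2 = (\<Sum>(x, y)\<in>cube n \<times> cube n. A t x * B t y * of_bool (A t x * B t y > L * (a * b / N\<^sup>2)))"
  have e0: "e1 \<ge> 0" "e2 \<ge> 0"
    unfolding e1_def e2_def using AB(1,2) by (auto intro!: sum_nonneg)
  have less': "1 / \<delta> * e1 + 8 * e2 < a * b"
    using less tot unfolding tp AB(3) e1_def e2_def by simp
  have "0 \<le> 1 / \<delta> * e1" using e0 \<open>\<delta> > 0\<close> by simp
  \<comment> \<open>Both summands are nonnegative, so each is below \<open>a * b\<close>, and
    strictness makes \<open>a * b\<close> positive.\<close>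
  hence e12: "e1 \<le> \<delta> * (a * b)" "e2 \<le> a * b / 8" "0 < a * b"
  proof -
    show "e2 \<le> a * b / 8" "0 < a * b" using \<open>0 \<le> 1 / \<delta> * e1\<close> less' e0 by linarith+
    have "1 / \<delta> * e1 \<le> a * b" using less' e0 by linarith
    thus "e1 \<le> \<delta> * (a * b)" using \<open>\<delta> > 0\<close> by (simp add: field_simps)
  qed
  have "a \<ge> 0" "b \<ge> 0" unfolding a_def b_def using AB by (auto intro!: sum_nonneg)
  hence ab: "a > 0" "b > 0" using e12(3) by (auto simp: zero_less_mult_iff)
  \<comment> \<open>The marginals of the posterior, scaled to sum to \<open>N\<close>, that is to
    mean 1.\<close>
  define u where "u = (\<lambda>x. A t x * (N / a))"
  define v where "v = (\<lambda>y. B t y * (N / b))"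
  have uv: "u x * v y = A t x * B t y * (N\<^sup>2 / (a * b))" for x y
    by (simp add: u_def v_def power2_eq_square)
  have factor: "(\<Sum>x\<in>cube n. \<Sum>y\<in>cube n. u x * v y * h x y)
      = (\<Sum>(x, y)\<in>cube n \<times> cube n. A t x * B t y * h x y) * (N\<^sup>2 / (a * b))" for h
    unfolding uv sum.cartesian_product sum_distrib_right by (intro sum.cong refl) auto
  have pos: "N\<^sup>2 / (a * b) > 0" using ab N by simp
  have "(\<Sum>x\<in>cube n. u x) = N" "(\<Sum>y\<in>cube n. v y) = N"
    using ab unfolding u_def v_def sum_distrib_right[symmetric] a_def[symmetric] b_def[symmetric] by simp_all
  moreover have "(\<Sum>x\<in>cube n. \<Sum>y\<in>cube n. u x * v y * of_bool (u x * v y > L)) \<le> N\<^sup>2 / 8"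
  proof -
    have *: "(u x * v y > L) = (A t x * B t y > L * (a * b / N\<^sup>2))" for x y
      unfolding uv using pos ab N by (simp add: field_simps)
    have "(\<Sum>x\<in>cube n. \<Sum>y\<in>cube n. u x * v y * of_bool (u x * v y > L)) = e2 * (N\<^sup>2 / (a * b))"
      unfolding factor e2_def * ..
    also have "\<dots> \<le> (a * b / 8) * (N\<^sup>2 / (a * b))" using e12 pos by (intro mult_right_mono) auto
    also have "\<dots> = N\<^sup>2 / 8" using ab by simp
    finally show ?thesis .
  qed
  moreover have "(\<Sum>x\<in>cube n. \<Sum>y\<in>cube n. u x * v y * of_bool (e x y)) \<le> \<delta> * N\<^sup>2"
  proof -
    have "(\<Sum>x\<in>cube n. \<Sum>y\<in>cube n. u x * v y * of_bool (e x y)) = e1 * (N\<^sup>2 / (a * b))"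
      unfolding factor e1_def ..
    also have "\<dots> \<le> (\<delta> * (a * b)) * (N\<^sup>2 / (a * b))" using e12 pos by (intro mult_right_mono) auto
    also have "\<dots> = \<delta> * N\<^sup>2" using ab by simp
    finally show ?thesis .
  qed
  moreover have "0 \<le> u x" "0 \<le> v x" for x using AB ab N by (auto simp: u_def v_def)
  ultimately show ?thesis
    using rectangle_of_product_density[of "cube n" "cube n" u v N L e \<delta> thesis] that N assms(1,2)
    by auto
qed

lemma map_execution_input: "map_pmf (\<lambda>(r, xy, t). xy) (execution P \<nu>) = \<nu>"
  using arg_cong[OF map_execution_public[of P \<nu>], of "map_pmf fst"]
  by (simp add: map_fst_pair_pmf map_pmf_comp case_prod_unfold)

lemma prob_execution_input:
  "measure_pmf.prob (execution P \<nu>) {(r, xy, t). xy \<in> S} = measure_pmf.prob \<nu> S"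
proof -
  have "measure_pmf.prob \<nu> S = measure_pmf.prob (map_pmf (\<lambda>(r, xy, t). xy) (execution P \<nu>)) S"
    by (simp only: map_execution_input)
  also have "\<dots> = measure_pmf.prob (execution P \<nu>) {(r, xy, t). xy \<in> S}"
    by (simp add: vimage_def case_prod_unfold)
  finally show ?thesis by simp
qed

lemma cb_truncated_GHD_le_icost:
  assumes \<theta>: "0 < \<theta>" "\<theta> \<le> 1 / 1600" and "n \<ge> 1"
    and upper: "measure_pmf.prob (\<mu> n) {(x, y). real_of_int (ip n x y) \<ge> a} \<le> \<theta>"
    and lower: "8 / 100 \<le> measure_pmf.prob (\<mu> n) {(x, y). real_of_int (ip n x y) \<ge> sqrt (real n)}"
    and comp: "computes (\<mu> n) \<theta> (GHD n) P"
  shows "cb (cube n) (cube n) 1 (\<mu> n) (400 * \<theta>) (truncated_GHD a n) \<le> ereal (400 * icost (\<mu> n) P + 1209)"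
proof -
  define E where "E = execution P (\<mu> n)"
  define I where "I = icost (\<mu> n) P"
  \<comment> \<open>Chosen so that \<open>(I + 2) / K\<close> is at most 1/200; the 3 keeps
    \<open>K\<close> positive, as only \<open>I \<ge> -2\<close> is known here.\<close>
  define K where "K = 200 * (I + 3)"
  define g where "g = truncated_GHD a n"
  define err where "err = (\<lambda>x y. g (x, y) \<notin> {Some 1, None})"
  define bad where "bad = (\<lambda>r x y t. pmf (transcript (snd P r) x y) t > 2 powr K * transcript_prob (\<mu> n) (snd P r) t)"
  define G where "G = (\<lambda>r t. out (snd P r) t = 1)"
  define wrong where "wrong = {(r, xy, t). GHD n xy \<noteq> None \<and> Some (out (snd P r) t) \<noteq> GHD n xy}"
  have fin: "finite (set_pmf (\<mu> n))" by (simp add: set_pmf_\<mu>)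
  have wrong: "measure_pmf.prob E wrong \<le> \<theta>"
    using comp unfolding computes_def E_def wrong_def .
  have I: "I \<ge> - 2"
    using icost_ge[OF fin, of 0 P] unfolding I_def by simp
  hence K: "K > 0" unfolding K_def by simp
  have Pbad: "measure_pmf.prob E {(r, (x, y), t). G r t \<and> bad r x y t} \<le> 1 / 200"
  proof -
    have "K * measure_pmf.prob E {(r, (x, y), t). bad r x y t} \<le> I + 2"
      using icost_ge[OF fin, of K P] K unfolding E_def I_def bad_def by simp
    also have "\<dots> \<le> K * (1 / 200)" by (simp add: K_def)
    finally have "measure_pmf.prob E {(r, (x, y), t). bad r x y t} \<le> 1 / 200"
      using K by (simp only: mult_le_cancel_left_pos)
    moreover have "measure_pmf.prob E {(r, (x, y), t). G r t \<and> bad r x y t} \<le> measure_pmf.prob E {(r, (x, y), t). bad r x y t}"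
      by (intro measure_pmf.finite_measure_mono) auto
    ultimately show ?thesis by linarith
  qed
  \<comment> \<open>Inner product at least \<open>sqrt n\<close> requires the answer 1, so the
    output is 1 with probability at least \<open>0.08 - \<theta>\<close>, and
    \<open>\<theta> \<le> 1/1600\<close> leaves 0.079.\<close>
  have PG: "79 / 1000 \<le> measure_pmf.prob E {(r, (x, y), t). G r t}"
  proof -
    have "measure_pmf.prob (\<mu> n) {(x, y). real_of_int (ip n x y) \<ge> sqrt (real n)}
        = measure_pmf.prob E {(r, xy, t). xy \<in> {(x, y). real_of_int (ip n x y) \<ge> sqrt (real n)}}"
      unfolding E_def by (rule prob_execution_input[symmetric])
    also have "\<dots> \<le> measure_pmf.prob E ({(r, (x, y), t). G r t} \<union> wrong)"
    proof (intro measure_pmf.finite_measure_mono)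
      have "sqrt (real n) > 0" using \<open>n \<ge> 1\<close> by simp
      hence "\<not> (sqrt (real n) \<le> i \<and> i \<le> - sqrt (real n))" for i by linarith
      thus "{(r, xy, t). xy \<in> {(x, y). real_of_int (ip n x y) \<ge> sqrt (real n)}} \<subseteq> {(r, (x, y), t). G r t} \<union> wrong"
        by (auto simp: wrong_def G_def GHD_def split: if_splits)
    qed auto
    also have "\<dots> \<le> measure_pmf.prob E {(r, (x, y), t). G r t} + measure_pmf.prob E wrong"
      by (intro measure_Un_le) auto
    finally show ?thesis using lower wrong \<theta> by linarith
  qed
  \<comment> \<open>If the output is 1 but \<open>g\<close> is -1, either GHD itself is -1 and the
    answer is wrong, or the inner product is at least \<open>a\<close>; each event has probability
    at most \<open>\<theta>\<close>.\<close>
  have Perr: "measure_pmf.prob E {(r, (x, y), t). G r t \<and> err x y} \<le> 2 * \<theta>"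
  proof -
    have "measure_pmf.prob E {(r, (x, y), t). G r t \<and> err x y}
      \<le> measure_pmf.prob E (wrong \<union> {(r, xy, t). xy \<in> {(x, y). real_of_int (ip n x y) \<ge> a}})"
    proof (rule measure_pmf.finite_measure_mono_AE)
      show "AE p in measure_pmf E. p \<in> {(r, (x, y), t). G r t \<and> err x y}
        \<longrightarrow> p \<in> wrong \<union> {(r, xy, t). xy \<in> {(x, y). real_of_int (ip n x y) \<ge> a}}"
      proof (rule AE_pmfI, rule impI)
        fix p assume p: "p \<in> set_pmf E" "p \<in> {(r, (x, y), t). G r t \<and> err x y}"
        obtain r x y t where [simp]: "p = (r, (x, y), t)" by (metis prod_cases4 surj_pair)
        have "(x, y) \<in> set_pmf (map_pmf (\<lambda>(r, xy, t). xy) E)"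
          using p(1) by (auto intro: rev_image_eqI)
        hence "x \<in> cube n" "y \<in> cube n" unfolding E_def map_execution_input set_pmf_\<mu> by auto
        thus "p \<in> wrong \<union> {(r, xy, t). xy \<in> {(x, y). real_of_int (ip n x y) \<ge> a}}"
          using p(2) by (auto simp: G_def err_def g_def truncated_GHD_def GHD_def wrong_def split: if_splits)
      qed
    qed auto
    also have "\<dots> \<le> measure_pmf.prob E wrong + measure_pmf.prob E {(r, xy, t). xy \<in> {(x, y). real_of_int (ip n x y) \<ge> a}}"
      by (intro measure_Un_le) auto
    also have "measure_pmf.prob E {(r, xy, t). xy \<in> {(x, y). real_of_int (ip n x y) \<ge> a}} \<le> \<theta>"
      using upper unfolding E_def prob_execution_input .
    finally show ?thesis using wrong by linarith
  qed
  \<comment> \<open>The final rectangle has error \<open>2 * \<delta> = 400 * \<theta>\<close>. The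
    averaging condition holds because \<open>1/100 + 8/200 < 79/1000\<close>.\<close>
  define \<delta> where "\<delta> = 200 * \<theta>"
  have \<delta>: "\<delta> > 0" using \<theta> by (simp add: \<delta>_def)
  have "1 / \<delta> * measure_pmf.prob E {(r, (x, y), t). G r t \<and> err x y} \<le> 1 / \<delta> * (2 * \<theta>)"
    using Perr \<delta> by (intro mult_left_mono) auto
  also have "\<dots> = 1 / 100" using \<theta> by (simp add: \<delta>_def)
  finally have "1 / \<delta> * measure_pmf.prob E {(r, (x, y), t). G r t \<and> err x y}
      + 8 * measure_pmf.prob E {(r, (x, y), t). G r t \<and> bad r x y t} < measure_pmf.prob E {(r, (x, y), t). G r t}"
    using Pbad PG by linarith
  then obtain r t where rt: "G r t"
    "1 / \<delta> * (\<Sum>(x, y)\<in>set_pmf (\<mu> n). pmf (\<mu> n) (x, y) * pmf (transcript (snd P r) x y) t * of_bool (err x y))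
     + 8 * (\<Sum>(x, y)\<in>set_pmf (\<mu> n). pmf (\<mu> n) (x, y) * pmf (transcript (snd P r) x y) t * of_bool (bad r x y t))
      < (\<Sum>(x, y)\<in>set_pmf (\<mu> n). pmf (\<mu> n) (x, y) * pmf (transcript (snd P r) x y) t)"
    unfolding E_def by (rule exists_transcript_below_average[OF fin])
  have scale: "(\<Sum>(x, y)\<in>set_pmf (\<mu> n). pmf (\<mu> n) (x, y) * pmf (transcript (snd P r) x y) t * h x y)
     = (\<Sum>(x, y)\<in>cube n \<times> cube n. pmf (transcript (snd P r) x y) t * h x y) / 4 ^ n" for h :: "int list \<Rightarrow> int list \<Rightarrow> real"
    unfolding sum_divide_distrib set_pmf_\<mu> by (intro sum.cong refl) (auto simp: pmf_\<mu>)
  have "1 / \<delta> * (\<Sum>(x, y)\<in>cube n \<times> cube n. pmf (transcript (snd P r) x y) t * of_bool (err x y))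
     + 8 * (\<Sum>(x, y)\<in>cube n \<times> cube n. pmf (transcript (snd P r) x y) t * of_bool (bad r x y t))
      < (\<Sum>(x, y)\<in>cube n \<times> cube n. pmf (transcript (snd P r) x y) t)"
  proof -
    define s1 where "s1 = (\<Sum>(x, y)\<in>cube n \<times> cube n. pmf (transcript (snd P r) x y) t * of_bool (err x y))"
    define s2 where "s2 = (\<Sum>(x, y)\<in>cube n \<times> cube n. pmf (transcript (snd P r) x y) t * of_bool (bad r x y t))"
    define s3 where "s3 = (\<Sum>(x, y)\<in>cube n \<times> cube n. pmf (transcript (snd P r) x y) t)"
    have scale1: "(\<Sum>(x, y)\<in>set_pmf (\<mu> n). pmf (\<mu> n) (x, y) * pmf (transcript (snd P r) x y) t) = s3 / 4 ^ n"
      using scale[of "\<lambda>_ _. 1"] unfolding s3_def by (simp only: mult_1_right)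
    have "1 / \<delta> * (s1 / 4 ^ n) + 8 * (s2 / 4 ^ n) < s3 / 4 ^ n"
      using rt(2) unfolding scale scale1 s1_def s2_def .
    hence "(1 / \<delta> * s1 + 8 * s2) / 4 ^ n < s3 / 4 ^ n" by (simp add: add_divide_distrib)
    hence "1 / \<delta> * s1 + 8 * s2 < s3" by (simp only: divide_less_cancel) simp
    thus ?thesis unfolding s1_def s2_def s3_def .
  qed
  then obtain S T where ST: "S \<subseteq> cube n" "T \<subseteq> cube n"
    "(\<Sum>x\<in>S. \<Sum>y\<in>T. of_bool (err x y)) \<le> 2 * \<delta> * (real (card S) * real (card T))"
    "4 ^ n / (512 * (2 powr K)\<^sup>2) \<le> real (card S) * real (card T)"
    unfolding bad_def using \<delta> by (elim rectangle_of_transcript[rotated 2]) auto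
  have finST: "finite S" "finite T" using ST(1,2) by (auto intro: finite_subset[OF _ finite_cube])
  have sub: "S \<times> T \<inter> cube n \<times> cube n = S \<times> T" using ST by auto
  have prob: "measure_pmf.prob (\<mu> n) (S \<times> T) = real (card S) * real (card T) / 4 ^ n"
    unfolding prob_\<mu> sub by (simp add: card_cartesian_product)
  have "monochromatic (\<mu> n) (400 * \<theta>) 1 g (S \<times> T)"
  proof -
    have "(S \<times> T - (g -` {Some 1} \<union> g -` {None})) \<inter> cube n \<times> cube n = {p \<in> S \<times> T. err (fst p) (snd p)}"
      using ST by (auto simp: err_def)
    moreover have "real (card {p \<in> S \<times> T. err (fst p) (snd p)}) = (\<Sum>x\<in>S. \<Sum>y\<in>T. of_bool (err x y))"
      unfolding sum.cartesian_product case_prod_unfold using finST by (simp add: of_bool_def sum.If_cases Int_def)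
    ultimately have "measure_pmf.prob (\<mu> n) (S \<times> T - (g -` {Some 1} \<union> g -` {None}))
      \<le> 2 * \<delta> * (real (card S) * real (card T)) / 4 ^ n"
      unfolding prob_\<mu> using ST(3) by (intro divide_right_mono) auto
    thus ?thesis unfolding monochromatic_def prob by (simp add: \<delta>_def)
  qed
  hence "cb (cube n) (cube n) 1 (\<mu> n) (400 * \<theta>) g \<le> ereal (- log 2 (1 / (512 * (2 powr K)\<^sup>2)))"
    using ST by (intro cb_le[of _ _ S T]) (auto simp: prob field_simps)
  \<comment> \<open>With \<open>512 = 2 ^ 9\<close> the bound is \<open>9 + 2 * K\<close>, that is
    \<open>400 * I + 1209\<close>.\<close>
  also have "- log 2 (1 / (512 * (2 powr K)\<^sup>2)) = 9 + 2 * K"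
  proof -
    have "(2::real) powr (9 + 2 * K) = 2 powr 9 * (2 powr K * 2 powr K)"
      by (simp only: powr_add mult_2)
    hence "(512 :: real) * (2 powr K)\<^sup>2 = 2 powr (9 + 2 * K)"
      by (simp add: power2_eq_square)
    hence "1 / ((512 :: real) * (2 powr K)\<^sup>2) = 2 powr (- (9 + 2 * K))"
      by (simp only: powr_minus_divide)
    thus ?thesis by (simp only: log_powr_cancel)
  qed
  finally show ?thesis by (simp add: g_def K_def I_def add.commute)
qed

section \<open>The lower bounds\<close>

text \<open>The constants depend on \<open>b\<close> only: \<open>c = 1\<close> and
  \<open>C = 2 * b\<close> for \<open>scb\<close>, \<open>c = 1/400\<close> and
  \<open>C = (1209 + 2 * b) / 400\<close> for \<open>IC\<close>. A distance below 1 admits both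
  roundings of the real number prescribed for \<open>n'\<close>.\<close>

theorem theorem4p4:
  fixes b :: real
  assumes "b \<ge> 100"
  shows "(\<exists>c>0. \<exists>C :: real. \<exists>N. \<forall>\<theta> n n'.
            tail (1.99 * b) \<le> \<theta> \<longrightarrow> \<theta> \<le> 1 / 1600 \<longrightarrow> n \<ge> N \<longrightarrow>
            \<bar>real n' - (real n + 1 / 2 * (1.99 * b - 1) * sqrt (real n))\<bar> < 1 \<longrightarrow>
            scb (cube n) (cube n) {-1, 1} 1 (\<mu> n) (400 * \<theta>) \<theta> (GHD n)
              \<ge> ereal c * cb (cube n') (cube n') 1 (\<mu> n') (400 * \<theta>) (ORT b n')
                 - ereal (C * sqrt (real n)))
       \<and> (\<exists>c>0. \<exists>C :: real. \<exists>N. \<forall>\<theta> n n'.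
            tail (1.99 * b) \<le> \<theta> \<longrightarrow> \<theta> \<le> 1 / 1600 \<longrightarrow> n \<ge> N \<longrightarrow>
            \<bar>real n' - (real n + 1 / 2 * (1.99 * b - 1) * sqrt (real n))\<bar> < 1 \<longrightarrow>
            IC {-1, 1} (\<mu> n) \<theta> (GHD n)
              \<ge> ereal c * cb (cube n') (cube n') 1 (\<mu> n') (400 * \<theta>) (ORT b n')
                 - ereal (C * sqrt (real n)))"
proof -
  define T where "T = 1.99 * b"
  have T1: "T \<ge> 1" using assms by (simp add: T_def)
  obtain N1 where N1: "\<And>n. n \<ge> N1 \<Longrightarrow>
      measure_pmf.prob (\<mu> n) {(x, y). real_of_int (ip n x y) \<ge> T * sqrt (real n) + 5} \<le> tail T"
    using sum_binom_prob_le_tail_shifted[OF T1] unfolding eventually_sequentially prob_\<mu>_ip_ge by blast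
  obtain N2 where N2: "\<And>n. n \<ge> N2 \<Longrightarrow>
      8 / 100 \<le> measure_pmf.prob (\<mu> n) {(x, y). real_of_int (ip n x y) \<ge> sqrt (real n)}"
    using sum_binom_prob_ge unfolding eventually_sequentially prob_\<mu>_ip_ge by blast
  define N where "N = max 1 (max N1 N2)"
  \<comment> \<open>Makes \<open>\<theta>\<close> positive, as the information bound divides by
    it.\<close>
  have tailT: "tail T > 0" using T1 by (intro tail_pos) simp
  have "ereal 1 * cb (cube n') (cube n') 1 (\<mu> n') (400 * \<theta>) (ORT b n') - ereal (2 * b * sqrt (real n))
       \<le> scb (cube n) (cube n) {-1, 1} 1 (\<mu> n) (400 * \<theta>) \<theta> (GHD n)"
    if A: "tail (1.99 * b) \<le> \<theta>" "\<theta> \<le> 1 / 1600" "n \<ge> N"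
      "\<bar>real n' - (real n + 1 / 2 * (1.99 * b - 1) * sqrt (real n))\<bar> < 1" for \<theta> n n'
  proof -
    define g where "g = truncated_GHD (1.99 * b * sqrt (real n) + 5) n"
    have n: "n \<ge> 1" "n \<ge> N1" using A(3) by (auto simp: N_def)
    have "cb (cube n') (cube n') 1 (\<mu> n') (400 * \<theta>) (ORT b n')
       \<le> cb (cube n) (cube n) 1 (\<mu> n) (400 * \<theta>) g + ereal (2 * b * sqrt (real n))"
      unfolding g_def by (intro cb_ORT_le_cb_truncated_GHD assms n A(4))
    also have "cb (cube n) (cube n) 1 (\<mu> n) (400 * \<theta>) g
      \<le> scb (cube n) (cube n) {-1, 1} 1 (\<mu> n) (400 * \<theta>) \<theta> (GHD n)"
    proof (rule cb_le_scb)
      show "g \<in> cube n \<times> cube n \<rightarrow>\<^sub>E insert None (Some ` {-1, 1})"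
        unfolding g_def by (rule truncated_GHD_in_PiE)
      show "measure_pmf.prob (\<mu> n) {p. GHD n p \<noteq> g p} \<le> \<theta>"
        unfolding g_def using prob_GHD_neq_truncated_GHD[of n "1.99 * b * sqrt (real n) + 5"] N1[OF n(2)] A(1)
        unfolding T_def by linarith
    qed auto
    finally show ?thesis by (simp add: ereal_minus_le add_right_mono)
  qed
  moreover have "ereal (1 / 400) * cb (cube n') (cube n') 1 (\<mu> n') (400 * \<theta>) (ORT b n')
       - ereal ((1209 + 2 * b) / 400 * sqrt (real n)) \<le> IC {-1, 1} (\<mu> n) \<theta> (GHD n)"
    if A: "tail (1.99 * b) \<le> \<theta>" "\<theta> \<le> 1 / 1600" "n \<ge> N"
      "\<bar>real n' - (real n + 1 / 2 * (1.99 * b - 1) * sqrt (real n))\<bar> < 1" for \<theta> n n'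
    unfolding IC_def
  proof (rule INF_greatest)
    fix P :: "(int list, int list, int) protocol"
    assume "P \<in> {P \<in> protocols {-1, 1}. computes (\<mu> n) \<theta> (GHD n) P}"
    hence comp: "computes (\<mu> n) \<theta> (GHD n) P" by simp
    have n: "n \<ge> 1" "n \<ge> N1" "n \<ge> N2" using A(3) by (auto simp: N_def)
    have \<theta>: "\<theta> > 0" using A(1) tailT by (simp add: T_def)
    have "cb (cube n') (cube n') 1 (\<mu> n') (400 * \<theta>) (ORT b n')
       \<le> cb (cube n) (cube n) 1 (\<mu> n) (400 * \<theta>) (truncated_GHD (1.99 * b * sqrt (real n) + 5) n) + ereal (2 * b * sqrt (real n))"
      by (intro cb_ORT_le_cb_truncated_GHD assms n A(4))
    also have "cb (cube n) (cube n) 1 (\<mu> n) (400 * \<theta>) (truncated_GHD (1.99 * b * sqrt (real n) + 5) n)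
       \<le> ereal (400 * icost (\<mu> n) P + 1209)"
      using N1[OF n(2)] N2[OF n(3)] A(1) unfolding T_def
      by (intro cb_truncated_GHD_le_icost \<theta> A(2) n(1) comp) auto
    finally have "cb (cube n') (cube n') 1 (\<mu> n') (400 * \<theta>) (ORT b n')
       \<le> ereal (400 * icost (\<mu> n) P + 1209 + 2 * b * sqrt (real n))"
      by (simp add: add_right_mono)
    hence "ereal (1 / 400) * cb (cube n') (cube n') 1 (\<mu> n') (400 * \<theta>) (ORT b n')
       \<le> ereal (1 / 400) * ereal (400 * icost (\<mu> n) P + 1209 + 2 * b * sqrt (real n))"
      by (intro ereal_mult_left_mono) auto
    \<comment> \<open>The additive constant 1209/400 is absorbed by
      \<open>sqrt n \<ge> 1\<close>.\<close>
    also have "\<dots> \<le> ereal (icost (\<mu> n) P) + ereal ((1209 + 2 * b) / 400 * sqrt (real n))"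
      using n(1) by (simp add: field_simps)
    finally show "ereal (1 / 400) * cb (cube n') (cube n') 1 (\<mu> n') (400 * \<theta>) (ORT b n')
       - ereal ((1209 + 2 * b) / 400 * sqrt (real n)) \<le> ereal (icost (\<mu> n) P)"
      by (simp add: ereal_minus_le)
  qed
  ultimately show ?thesis
    by (intro conjI exI[of _ "1::real"] exI[of _ "1 / 400 :: real"] exI[of _ "2 * b"]
        exI[of _ "(1209 + 2 * b) / 400"] exI[of _ N]) auto
qed

end
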